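(* Let $\mathcal{M} = \mathbb{S}^{d_1} \times \cdots \times \mathbb{S}^{d_N}$ be a product of spheres (not necessarily all of the same dimension). If $f \colon \mathcal{M} \to \mathbb{R}$ is $C^2$ and $\mathrm{grad} f$ is $L$-Lipschitz continuous with $L>0$, then Riemannian gradient descent with the metric projection retraction, $x_{t+1} = g(x_t)$ with $g(x) = \mathcal{P}_{\mathcal{M}}(x - \alpha\, \mathrm{grad} f(x))$, with step size $0 < \alpha < \frac{1}{L}$, avoids the strict saddles of $f$: the set of initial points $x_0 \in \mathcal{M}$ such that $(x_t)_{t\ge0}$ converges to a strict saddle of $f$ has measure zero in $\mathcal{M}$.
   Context: $\mathbb{S}^d = \{x \in \mathbb{R}^{d+1} : \|x\|=1\}$, and $\mathcal{M}$ is regarded as a Riemannian submanifold of the Euclidean space $\mathcal{E} = \mathbb{R}^{d_1+1} \times \cdots \times \mathbb{R}^{d_N+1}$, i.e. with the metric $\langle u,v\rangle = u^\top v$ restricted to tangent spaces. $\mathcal{P}_{\mathcal{M}}(y) = \operatorname{argmin}_{z\in\mathcal{M}} \|z-y\|$ is the metric projection; for a product of spheres it normalizes each component, $\mathcal{P}_{\mathcal{M}}(y_1,\dots,y_N) = (y_1/\|y_1\|, \dots, y_N/\|y_N\|)$ when all $y_i \neq 0$, so $g$ is defined on all of $\mathcal{M}$. $\mathrm{grad} f$ and $\mathrm{Hess} f$ are the Riemannian gradient and Hessian. $\mathrm{grad} f$ is $L$-Lipschitz continuous if $\|\mathrm{Hess} f(x)[u]\| \le L\|u\|$ for all $x \in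 \mathcal{M}$, $u \in \mathrm{T}_x\mathcal{M}$. A strict saddle of $f$ is a point $x^*$ with $\mathrm{grad} f(x^* ) = 0$ at which $\mathrm{Hess} f(x^* )$ has at least one negative eigenvalue. A subset $A \subseteq \mathcal{M}$ (with $n=\dim\mathcal{M}$) has measure zero if $\varphi(A\cap U) \subseteq \mathbb{R}^n$ has Lebesgue measure zero for every smooth chart $(U,\varphi)$. *)

theory Defs
  imports "HOL-Analysis.Analysis"
begin

section \<open>Functions of class C^k\<close>

text \<open>In finite dimension, continuity of all directional derivatives
  \<open>x \<mapsto> f' x v\<close> is continuity of the derivative \<open>f'\<close> itself, and likewise for higher orders.
  Only meaningful for open \<open>S\<close>.\<close>

primrec Cn_on :: "nat \<Rightarrow> ('a::euclidean_space \<Rightarrow> 'b::euclidean_space) \<Rightarrow> 'a set \<Rightarrow> bool" where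
  "Cn_on 0 f S \<longleftrightarrow> continuous_on S f"
| "Cn_on (Suc n) f S \<longleftrightarrow>
     (\<exists>f'. (\<forall>x\<in>S. (f has_derivative f' x) (at x)) \<and> (\<forall>v. Cn_on n (\<lambda>x. f' x v) S))"

definition Ck_on :: "enat \<Rightarrow> ('a::euclidean_space \<Rightarrow> 'b::euclidean_space) \<Rightarrow> 'a set \<Rightarrow> bool" where
  "Ck_on k f S \<longleftrightarrow> (\<forall>n. enat n \<le> k \<longrightarrow> Cn_on n f S)"

text \<open>A function on a subset of Euclidean space (here: on a relatively open part of an embedded
  submanifold) is of class C^k if it locally extends to a C^k function on an open set of the
  ambient space.\<close>

definition Ck_on_submanifold ::
    "enat \<Rightarrow> ('a::euclidean_space \<Rightarrow> 'b::euclidean_space) \<Rightarrow> 'a set \<Rightarrow> bool" where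
  "Ck_on_submanifold k f M \<longleftrightarrow>
     (\<forall>x\<in>M. \<exists>V F. open V \<and> x \<in> V \<and> Ck_on k F V \<and> (\<forall>y\<in>V \<inter> M. F y = f y))"

section \<open>Riemannian geometry of a submanifold of Euclidean space\<close>

text \<open>Velocities of smooth curves in \<open>M\<close> through \<open>x\<close>.\<close>

definition tangent_space :: "'a::euclidean_space set \<Rightarrow> 'a \<Rightarrow> 'a set" where
  "tangent_space M x =
     {v. \<exists>c \<epsilon>. \<epsilon> > 0 \<and> Ck_on \<infinity> c {-\<epsilon><..<\<epsilon>} \<and> (\<forall>t\<in>{-\<epsilon><..<\<epsilon>}. c t \<in> M) \<and>
         c (0::real) = x \<and> (c has_vector_derivative v) (at 0)}"

text \<open>The differential of a map on \<open>M\<close>. The Frechet derivative within \<open>M\<close> is not unique as a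
  linear map on the ambient space, but by the chain rule its value at a tangent vector
  \<open>v = c'(0)\<close> is \<open>(f \<circ> c)'(0)\<close>, so it is uniquely determined on \<open>tangent_space M x\<close>. The
  definitions below apply it to tangent vectors only. It depends only on the values of \<open>f\<close>
  on \<open>M\<close>.\<close>

definition differential_on ::
    "'a::euclidean_space set \<Rightarrow> ('a \<Rightarrow> 'b::euclidean_space) \<Rightarrow> 'a \<Rightarrow> 'a \<Rightarrow> 'b" where
  "differential_on M f x = frechet_derivative f (at x within M)"

definition riemannian_grad :: "'a::euclidean_space set \<Rightarrow> ('a \<Rightarrow> real) \<Rightarrow> 'a \<Rightarrow> 'a" where
  "riemannian_grad M f x =
     (THE v. v \<in> tangent_space M x \<and>
             (\<forall>u\<in>tangent_space M x. differential_on M f x u = v \<bullet> u))"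

text \<open>The covariant derivative of the gradient field. The Levi-Civita connection of a
  submanifold with the induced metric is the Euclidean derivative followed by orthogonal
  projection to the tangent space.\<close>

definition riemannian_Hess ::
    "'a::euclidean_space set \<Rightarrow> ('a \<Rightarrow> real) \<Rightarrow> 'a \<Rightarrow> 'a \<Rightarrow> 'a" where
  "riemannian_Hess M f x u =
     closest_point (tangent_space M x) (differential_on M (riemannian_grad M f) x u)"

definition grad_Lipschitz :: "'a::euclidean_space set \<Rightarrow> ('a \<Rightarrow> real) \<Rightarrow> real \<Rightarrow> bool" where
  "grad_Lipschitz M f L \<longleftrightarrow>
     (\<forall>x\<in>M. \<forall>u\<in>tangent_space M x. norm (riemannian_Hess M f x u) \<le> L * norm u)"

definition strict_saddle :: "'a::euclidean_space set \<Rightarrow> ('a \<Rightarrow> real) \<Rightarrow> 'a \<Rightarrow> bool" where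
  "strict_saddle M f x \<longleftrightarrow> x \<in> M \<and> riemannian_grad M f x = 0 \<and>
     (\<exists>\<mu><0. \<exists>u\<in>tangent_space M x. u \<noteq> 0 \<and> riemannian_Hess M f x u = \<mu> *\<^sub>R u)"

text \<open>\<open>closest_point M\<close> is the metric projection, a minimizer over \<open>M\<close> of the distance.\<close>

definition RGD_step :: "'a::euclidean_space set \<Rightarrow> ('a \<Rightarrow> real) \<Rightarrow> real \<Rightarrow> 'a \<Rightarrow> 'a" where
  "RGD_step M f \<alpha> x = closest_point M (x - \<alpha> *\<^sub>R riemannian_grad M f x)"

section \<open>Charts and sets of measure zero\<close>

definition smooth_chart ::
    "'a::euclidean_space set \<Rightarrow> 'a set \<Rightarrow> ('a \<Rightarrow> 'b::euclidean_space) \<Rightarrow> bool" where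
  "smooth_chart M U \<phi> \<longleftrightarrow>
     openin (top_of_set M) U \<and> open (\<phi> ` U) \<and> inj_on \<phi> U \<and>
     Ck_on_submanifold \<infinity> \<phi> U \<and> Ck_on \<infinity> (inv_into U \<phi>) (\<phi> ` U)"

text \<open>The type \<open>real ^ 'm\<close> is the model space of the charts; the notion is only meaningful
  when \<open>CARD('m)\<close> is the dimension of \<open>M\<close> (otherwise there are no nonempty charts).\<close>

definition measure_zero_in ::
    "'m::finite itself \<Rightarrow> 'a::euclidean_space set \<Rightarrow> 'a set \<Rightarrow> bool" where
  "measure_zero_in _ M A \<longleftrightarrow> A \<subseteq> M \<and>
     (\<forall>U (\<phi> :: 'a \<Rightarrow> real ^ 'm). smooth_chart M U \<phi> \<longrightarrow> \<phi> ` (A \<inter> U) \<in> null_sets lebesgue)"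

section \<open>Products of spheres\<close>

text \<open>The factors may have different dimensions, so the product of the Euclidean spaces
  \<open>\<real>^(d k + 1)\<close>, \<open>k :: 'k\<close>, is represented as a single space \<open>real ^ 'n\<close> whose coordinates are
  partitioned by \<open>b :: 'n \<Rightarrow> 'k\<close>: the coordinates of the \<open>k\<close>-th factor are those in the fibre
  \<open>b -` {k}\<close>, which has \<open>d k + 1\<close> elements. The inner product of \<open>real ^ 'n\<close> is that of the
  product.\<close>

definition sphere_product :: "('n::finite \<Rightarrow> 'k::finite) \<Rightarrow> (real ^ 'n) set" where
  "sphere_product b = {x. \<forall>k. L2_set (\<lambda>i. x $ i) (b -` {k}) = 1}"

end

theory Submission
  imports Defs
begin

text \<open>Extend \<open>f\<close> to vectors with nonzero blocks, constant along positive block scalings. The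
  gradient \<open>h\<close> of the extension restricts to the Riemannian gradient, and the gradient step extends
  to a \<open>C\<^sup>1\<close> map \<open>G\<close> on an open set of the ambient space that commutes with block scalings. A subset of
  the product of spheres has measure zero as soon as the cone over it is negligible.

  If \<open>DG(x) v = 0\<close> at a point \<open>x\<close> of the manifold, then \<open>v\<close> is tangent and
  \<open>v - \<alpha> Hess f(x) v + \<alpha>\<^sup>2 \<Sum>\<^sub>k \<langle>v\<^sub>k, h\<^sub>k\<rangle> h\<^sub>k\<close> has inner product \<open>0\<close> with \<open>v\<close>, which forces \<open>v = 0\<close> because
  \<open>\<alpha> L < 1\<close>. So preimages of negligible sets under \<open>G\<close> are negligible. At a strict saddle
  \<open>DG(x) = I - \<alpha> Dh(x)\<close> is symmetric with an eigenvalue above \<open>1\<close>, and the points whose orbits remain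
  near \<open>x\<close> form a negligible set. Countably many such neighbourhoods cover all saddles and their
  rescalings.\<close>

section \<open>Calculus of C^n maps\<close>

lemma Cn_on_imp_continuous_on: "Cn_on n f S \<Longrightarrow> continuous_on S f"
  by (cases n) (auto intro!: continuous_at_imp_continuous_on dest!: bspec has_derivative_continuous)

lemma Cn_on_SucD: "Cn_on (Suc n) f S \<Longrightarrow> Cn_on n f S"
proof (induction n arbitrary: f)
  case 0
  then show ?case using Cn_on_imp_continuous_on by fastforce
next
  case (Suc n)
  then obtain f' where "\<forall>x\<in>S. (f has_derivative f' x) (at x)" "\<forall>v. Cn_on (Suc n) (\<lambda>x. f' x v) S"
    unfolding Cn_on.simps(2)[of "Suc n"] by blast
  then show ?case using Suc.IH unfolding Cn_on.simps(2)[of n] by blast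
qed

lemma Cn_on_subset: "Cn_on n f S \<Longrightarrow> T \<subseteq> S \<Longrightarrow> Cn_on n f T"
proof (induction n arbitrary: f)
  case 0
  then show ?case using continuous_on_subset by auto
next
  case (Suc n)
  then show ?case by (simp only: Cn_on.simps) (meson subsetD)
qed

lemma Cn_on_cong:
  assumes "Cn_on n f S" "open S" "\<And>x. x \<in> S \<Longrightarrow> f x = g x"
  shows "Cn_on n g S"
proof (cases n)
  case 0
  then show ?thesis using assms by (auto cong: continuous_on_cong_simp)
next
  case (Suc m)
  then obtain f' where f': "\<forall>x\<in>S. (f has_derivative f' x) (at x)" "\<forall>v. Cn_on m (\<lambda>x. f' x v) S"
    using assms(1) by auto
  have "(g has_derivative f' x) (at x)" if "x \<in> S" for x
    using f'(1) that assms(2,3) by (blast intro: has_derivative_transform_within_open)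
  then show ?thesis using Suc f'(2) by auto
qed

lemma Cn_on_locally:
  assumes "\<And>x. x \<in> S \<Longrightarrow> \<exists>V. open V \<and> x \<in> V \<and> Cn_on n f V"
  shows "Cn_on n f S"
  using assms
proof (induction n arbitrary: f)
  case 0
  have "isCont f x" if "x \<in> S" for x
    using 0[OF that] by (auto simp: continuous_on_eq_continuous_at)
  then show ?case by (simp add: continuous_at_imp_continuous_on)
next
  case (Suc n)
  have *: "\<exists>V. open V \<and> x \<in> V \<and> (\<forall>y\<in>V. (f has_derivative frechet_derivative f (at y)) (at y)) \<and>
      (\<forall>v. Cn_on n (\<lambda>y. frechet_derivative f (at y) v) V)" if x: "x \<in> S" for x
  proof -
    obtain V f' where V: "open V" "x \<in> V" and f': "\<forall>y\<in>V. (f has_derivative f' y) (at y)"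
      "\<forall>v. Cn_on n (\<lambda>y. f' y v) V"
      using Suc.prems[OF x] unfolding Cn_on.simps by blast
    have eq: "frechet_derivative f (at y) = f' y" if "y \<in> V" for y
      using f'(1) that by (metis frechet_derivative_at)
    have "Cn_on n (\<lambda>y. frechet_derivative f (at y) v) V" for v
      using f'(2) V(1) eq by (auto intro: Cn_on_cong[where f = "\<lambda>y. f' y v"])
    then show ?thesis using V f'(1) eq by auto
  qed
  have "Cn_on n (\<lambda>x. frechet_derivative f (at x) v) S" for v
    using * by (intro Suc.IH) blast
  moreover have "\<forall>x\<in>S. (f has_derivative frechet_derivative f (at x)) (at x)" using * by blast
  ultimately show ?case unfolding Cn_on.simps by (intro exI[of _ "\<lambda>x. frechet_derivative f (at x)"]) simp
qed

lemma Cn_on_const [simp]: "Cn_on n (\<lambda>x. c) S"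
proof (induction n arbitrary: c)
  case (Suc n)
  then show ?case unfolding Cn_on.simps by (intro exI[of _ "\<lambda>x v. 0"]) auto
qed auto

lemma Cn_on_linear_compose:
  assumes "bounded_linear L" "Cn_on n f S"
  shows "Cn_on n (\<lambda>x. L (f x)) S"
  using assms(2)
proof (induction n arbitrary: f)
  case 0
  then show ?case using assms(1) by (simp add: bounded_linear.continuous_on)
next
  case (Suc n)
  then obtain f' where f': "\<forall>x\<in>S. (f has_derivative f' x) (at x)" "\<forall>v. Cn_on n (\<lambda>x. f' x v) S"
    by auto
  then show ?case unfolding Cn_on.simps
    using Suc.IH bounded_linear.has_derivative[OF assms(1)]
    by (intro exI[of _ "\<lambda>x v. L (f' x v)"]) blast
qed

lemma Cn_on_id [simp]: "Cn_on n (\<lambda>x. x) S"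
  by (cases n) (auto intro!: exI[of _ "\<lambda>x v. v"])

lemma Cn_on_add: "Cn_on n f S \<Longrightarrow> Cn_on n g S \<Longrightarrow> Cn_on n (\<lambda>x. f x + g x) S"
proof (induction n arbitrary: f g)
  case 0
  then show ?case by (simp add: continuous_on_add)
next
  case (Suc n)
  then obtain f' g' where
    "\<forall>x\<in>S. (f has_derivative f' x) (at x)" "\<forall>v. Cn_on n (\<lambda>x. f' x v) S"
    "\<forall>x\<in>S. (g has_derivative g' x) (at x)" "\<forall>v. Cn_on n (\<lambda>x. g' x v) S" by auto
  then show ?case unfolding Cn_on.simps using Suc.IH
    by (intro exI[of _ "\<lambda>x v. f' x v + g' x v"]) (blast intro: has_derivative_add)
qed

lemma Cn_on_sum:
  assumes "\<And>i. i \<in> I \<Longrightarrow> Cn_on n (f i) S"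
  shows "Cn_on n (\<lambda>x. \<Sum>i\<in>I. f i x) S"
  using assms by (induction I rule: infinite_finite_induct) (simp_all add: Cn_on_add)

lemma Cn_on_scaleR:
  fixes f :: "'a::euclidean_space \<Rightarrow> real"
  shows "Cn_on n f S \<Longrightarrow> Cn_on n g S \<Longrightarrow> Cn_on n (\<lambda>x. f x *\<^sub>R g x) S"
proof (induction n arbitrary: f g)
  case 0
  then show ?case by (simp add: continuous_on_scaleR)
next
  case (Suc n)
  then obtain f' g' where *:
    "\<forall>x\<in>S. (f has_derivative f' x) (at x)" "\<forall>v. Cn_on n (\<lambda>x. f' x v) S"
    "\<forall>x\<in>S. (g has_derivative g' x) (at x)" "\<forall>v. Cn_on n (\<lambda>x. g' x v) S" by auto
  have "Cn_on n f S" "Cn_on n g S" using Suc.prems Cn_on_SucD by auto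
  then have "Cn_on n (\<lambda>x. f x *\<^sub>R g' x v + f' x v *\<^sub>R g x) S" for v
    using *(2,4) Suc.IH by (intro Cn_on_add) auto
  then show ?case unfolding Cn_on.simps using *(1,3)
    by (intro exI[of _ "\<lambda>x v. f x *\<^sub>R g' x v + f' x v *\<^sub>R g x"]) (blast intro: has_derivative_scaleR)
qed

lemma Cn_on_mult:
  fixes f g :: "'a::euclidean_space \<Rightarrow> real"
  shows "Cn_on n f S \<Longrightarrow> Cn_on n g S \<Longrightarrow> Cn_on n (\<lambda>x. f x * g x) S"
  using Cn_on_scaleR[of n f S g] by simp

lemma Cn_on_minus: "Cn_on n f S \<Longrightarrow> Cn_on n (\<lambda>x. - f x) S"
  using Cn_on_linear_compose[OF bounded_linear_minus[OF bounded_linear_ident]] by blast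

lemma Cn_on_diff: "Cn_on n f S \<Longrightarrow> Cn_on n g S \<Longrightarrow> Cn_on n (\<lambda>x. f x - g x) S"
  using Cn_on_add[of n f S "\<lambda>x. - g x"] Cn_on_minus[of n g S] by simp

lemma Cn_on_compose:
  assumes "Cn_on n g T" "Cn_on n f S" "f ` S \<subseteq> T"
  shows "Cn_on n (\<lambda>x. g (f x)) S"
  using assms
proof (induction n arbitrary: g f)
  case 0
  then show ?case using continuous_on_compose2 by auto
next
  case (Suc n)
  then obtain f' g' where *:
    "\<forall>x\<in>S. (f has_derivative f' x) (at x)" "\<forall>v. Cn_on n (\<lambda>x. f' x v) S"
    "\<forall>x\<in>T. (g has_derivative g' x) (at x)" "\<forall>v. Cn_on n (\<lambda>x. g' x v) T" by auto
  have der: "((\<lambda>x. g (f x)) has_derivative (\<lambda>v. g' (f x) (f' x v))) (at x)" if "x \<in> S" for x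
    using *(1,3) Suc.prems(3) that by (intro has_derivative_compose[of f _ x UNIV g]) auto
  have lin: "linear (g' (f x))" if "x \<in> S" for x
    using *(3) Suc.prems(3) that has_derivative_linear by blast
  have eq: "g' (f x) w = (\<Sum>j\<in>Basis. (w \<bullet> j) *\<^sub>R g' (f x) j)" if "x \<in> S" for x w
    using lin[OF that] by (subst euclidean_representation[of w, symmetric])
      (simp add: linear_sum linear_scale del: euclidean_representation)
  have "Cn_on n (\<lambda>x. \<Sum>j\<in>Basis. (f' x v \<bullet> j) *\<^sub>R g' (f x) j) S" for v
    using *(2,4) Suc.prems Cn_on_SucD[of n f S]
    by (intro Cn_on_sum Cn_on_scaleR Cn_on_linear_compose[OF bounded_linear_inner_left] Suc.IH) auto
  moreover have "\<forall>x\<in>S. ((\<lambda>x. g (f x)) has_derivative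
      (\<lambda>v. \<Sum>j\<in>Basis. (f' x v \<bullet> j) *\<^sub>R g' (f x) j)) (at x)"
  proof
    fix x assume x: "x \<in> S"
    have "(\<lambda>v. g' (f x) (f' x v)) = (\<lambda>v. \<Sum>j\<in>Basis. (f' x v \<bullet> j) *\<^sub>R g' (f x) j)"
      by (rule ext) (rule eq[OF x])
    from der[OF x, unfolded this] show "((\<lambda>x. g (f x)) has_derivative
      (\<lambda>v. \<Sum>j\<in>Basis. (f' x v \<bullet> j) *\<^sub>R g' (f x) j)) (at x)" .
  qed
  ultimately show ?case unfolding Cn_on.simps by (intro exI[of _ "\<lambda>x v. \<Sum>j\<in>Basis. (f' x v \<bullet> j) *\<^sub>R g' (f x) j"]) auto
qed

lemma Cn_on_powr: "Cn_on n (\<lambda>x::real. c * x powr p) {0<..}"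
proof (induction n arbitrary: c p)
  case 0
  have "continuous_on {0<..} (\<lambda>x::real. x powr p)"
    by (intro continuous_on_powr continuous_intros) auto
  then show ?case by (auto intro!: continuous_intros)
next
  case (Suc n)
  have "((\<lambda>x. c * x powr p) has_derivative (\<lambda>v. v * (c * p) * x powr (p - 1))) (at x)" if "x > 0" for x
  proof -
    have "((\<lambda>x. c * x powr p) has_real_derivative (c * p) * x powr (p - 1)) (at x)"
      using that by (auto intro!: derivative_eq_intros)
    then show ?thesis by (simp add: has_field_derivative_def mult_commute_abs mult.assoc)
  qed
  then show ?case unfolding Cn_on.simps using Suc.IH
    by (intro exI[of _ "\<lambda>x v. v * (c * p) * x powr (p - 1)"]) auto
qed

lemma Cn_on_powr_compose:
  fixes f :: "'a::euclidean_space \<Rightarrow> real"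
  assumes "Cn_on n f S" "\<And>x. x \<in> S \<Longrightarrow> 0 < f x"
  shows "Cn_on n (\<lambda>x. f x powr p) S"
  using Cn_on_compose[OF Cn_on_powr[of n 1 p] assms(1)] assms(2) by auto

lemma has_derivative_strict:
  fixes f :: "'a::euclidean_space \<Rightarrow> 'b::euclidean_space"
  assumes "open S" and f': "\<And>x. x \<in> S \<Longrightarrow> (f has_derivative f' x) (at x)"
    and cont: "\<And>v. continuous_on S (\<lambda>x. f' x v)" and x: "x \<in> S" and "\<epsilon> > 0"
  shows "\<exists>\<delta>>0. \<forall>y\<in>ball x \<delta>. \<forall>z\<in>ball x \<delta>. norm (f y - f z - f' x (y - z)) \<le> \<epsilon> * norm (y - z)"
proof -
  define c where "c y = (\<Sum>b\<in>Basis. norm (f' y b - f' x b))" for y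
  have "continuous_on S c" unfolding c_def by (intro continuous_intros cont)
  then have "isCont c x" using assms(1) x continuous_on_eq_continuous_at by blast
  then have "c \<midarrow>x\<rightarrow> c x" by (simp add: isCont_def)
  moreover have "c x = 0" by (simp add: c_def)
  ultimately have "\<forall>\<^sub>F y in at x. c y < \<epsilon>" using assms(5) by (simp add: order_tendstoD)
  then obtain d1 where d1: "d1 > 0" "\<And>y. y \<noteq> x \<Longrightarrow> dist y x < d1 \<Longrightarrow> c y < \<epsilon>"
    by (auto simp: eventually_at)
  obtain d2 where d2: "d2 > 0" "ball x d2 \<subseteq> S" using assms(1) x open_contains_ball by blast
  define \<delta> where "\<delta> = min d1 d2"
  have \<delta>: "\<delta> > 0" "ball x \<delta> \<subseteq> S" using d1 d2 by (auto simp: \<delta>_def)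
  have c: "c y \<le> \<epsilon>" if "y \<in> ball x \<delta>" for y
    using d1(2)[of y] that \<open>c x = 0\<close> assms(5) by (cases "y = x") (auto simp: \<delta>_def dist_commute)
  have on: "onorm (\<lambda>v. f' y v - f' x v) \<le> \<epsilon>" if y: "y \<in> ball x \<delta>" for y
  proof -
    have "bounded_linear (\<lambda>v. f' y v - f' x v)"
      using f'[OF subsetD[OF \<delta>(2) y]] f'[OF x] by (intro bounded_linear_sub) (auto intro: has_derivative_bounded_linear)
    then have "onorm (\<lambda>v. f' y v - f' x v) \<le> c y"
      unfolding c_def by (rule onorm_componentwise)
    then show ?thesis using c[OF y] by linarith
  qed
  have "norm (f y - f z - f' x (y - z)) \<le> \<epsilon> * norm (y - z)" if yz: "y \<in> ball x \<delta>" "z \<in> ball x \<delta>" for y z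
  proof -
    have lin: "bounded_linear (f' x)" using f'[OF x] by (rule has_derivative_bounded_linear)
    have "norm ((f y - f' x y) - (f z - f' x z)) \<le> \<epsilon> * norm (y - z)"
    proof (rule differentiable_bound[OF convex_ball _ on yz])
      fix w assume w: "w \<in> ball x \<delta>"
      show "((\<lambda>w. f w - f' x w) has_derivative (\<lambda>v. f' w v - f' x v)) (at w within ball x \<delta>)"
        using f'[OF subsetD[OF \<delta>(2) w]] by (intro has_derivative_diff bounded_linear_imp_has_derivative[OF lin])
          (auto intro: has_derivative_at_withinI)
    qed
    then show ?thesis by (simp add: linear_diff bounded_linear.linear[OF lin] algebra_simps)
  qed
  then show ?thesis using \<delta>(1) by blast
qed

lemma second_difference_mean_value:
  fixes f :: "'a::euclidean_space \<Rightarrow> real"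
  assumes f': "\<And>y. y \<in> S \<Longrightarrow> (f has_derivative f' y) (at y)"
    and f'': "\<And>y. y \<in> S \<Longrightarrow> ((\<lambda>y. f' y u) has_derivative f'' y) (at y)"
    and sub: "\<And>r s. r \<in> {0..t} \<Longrightarrow> s \<in> {0..t} \<Longrightarrow> x + r *\<^sub>R u + s *\<^sub>R v \<in> S" and "0 < t"
  shows "\<exists>r\<in>{0..t}. \<exists>s\<in>{0..t}.
    f (x + t *\<^sub>R u + t *\<^sub>R v) - f (x + t *\<^sub>R u) - f (x + t *\<^sub>R v) + f x = t\<^sup>2 * f'' (x + r *\<^sub>R u + s *\<^sub>R v) v"
proof -
  have sub0: "x + r *\<^sub>R u \<in> S" if "r \<in> {0..t}" for r
    using sub[of r 0] that assms(4) by simp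
  define \<phi> where "\<phi> r = f (x + r *\<^sub>R u + t *\<^sub>R v) - f (x + r *\<^sub>R u)" for r
  have "(\<phi> has_real_derivative (f' (x + r *\<^sub>R u + t *\<^sub>R v) u - f' (x + r *\<^sub>R u) u)) (at r)"
    if r: "0 \<le> r" "r \<le> t" for r
  proof -
    have 1: "((\<lambda>r. x + r *\<^sub>R u + t *\<^sub>R v) has_derivative (\<lambda>h. h *\<^sub>R u)) (at r)"
      and 2: "((\<lambda>r. x + r *\<^sub>R u) has_derivative (\<lambda>h. h *\<^sub>R u)) (at r)"
      by (auto intro!: derivative_eq_intros)
    have p: "x + r *\<^sub>R u + t *\<^sub>R v \<in> S" "x + r *\<^sub>R u \<in> S"
      using r assms(4) by (auto intro: sub sub0)
    have "(\<phi> has_derivative (\<lambda>h. f' (x + r *\<^sub>R u + t *\<^sub>R v) (h *\<^sub>R u) - f' (x + r *\<^sub>R u) (h *\<^sub>R u))) (at r)"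
      unfolding \<phi>_def
      by (intro has_derivative_diff has_derivative_compose[OF 1 f'[OF p(1)]] has_derivative_compose[OF 2 f'[OF p(2)]])
    moreover have "f' y (h *\<^sub>R u) = h * f' y u" if "y \<in> S" for y h
      using has_derivative_linear[OF f'[OF that]] by (simp add: linear_scale)
    ultimately have "(\<phi> has_derivative (\<lambda>h. h * (f' (x + r *\<^sub>R u + t *\<^sub>R v) u - f' (x + r *\<^sub>R u) u))) (at r)"
      using p by (simp add: right_diff_distrib)
    then show ?thesis by (simp add: has_field_derivative_def mult_commute_abs)
  qed
  from MVT2[OF assms(4) this] obtain r where r: "0 < r" "r < t"
      "\<phi> t - \<phi> 0 = (t - 0) * (f' (x + r *\<^sub>R u + t *\<^sub>R v) u - f' (x + r *\<^sub>R u) u)"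
    by blast
  define \<psi> where "\<psi> s = f' (x + r *\<^sub>R u + s *\<^sub>R v) u" for s
  have "(\<psi> has_real_derivative f'' (x + r *\<^sub>R u + s *\<^sub>R v) v) (at s)" if s: "0 \<le> s" "s \<le> t" for s
  proof -
    have 1: "((\<lambda>s. x + r *\<^sub>R u + s *\<^sub>R v) has_derivative (\<lambda>h. h *\<^sub>R v)) (at s)"
      by (auto intro!: derivative_eq_intros)
    have p: "x + r *\<^sub>R u + s *\<^sub>R v \<in> S" using r s by (auto intro: sub)
    have "(\<psi> has_derivative (\<lambda>h. f'' (x + r *\<^sub>R u + s *\<^sub>R v) (h *\<^sub>R v))) (at s)"
      unfolding \<psi>_def by (rule has_derivative_compose[OF 1 f''[OF p]])
    moreover have "f'' (x + r *\<^sub>R u + s *\<^sub>R v) (h *\<^sub>R v) = h * f'' (x + r *\<^sub>R u + s *\<^sub>R v) v" for h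
      using has_derivative_linear[OF f''[OF p]] by (simp add: linear_scale)
    ultimately show ?thesis by (simp add: has_field_derivative_def mult_commute_abs)
  qed
  from MVT2[OF assms(4) this] obtain s where s: "0 < s" "s < t"
      "\<psi> t - \<psi> 0 = (t - 0) * f'' (x + r *\<^sub>R u + s *\<^sub>R v) v"
    by blast
  have "\<phi> t - \<phi> 0 = t\<^sup>2 * f'' (x + r *\<^sub>R u + s *\<^sub>R v) v"
    using r(3) s(3) by (simp add: \<psi>_def power2_eq_square)
  then show ?thesis using r s
    by (intro bexI[of _ r] bexI[of _ s]) (simp_all add: \<phi>_def)
qed

lemma second_derivative_symmetric:
  fixes f :: "'a::euclidean_space \<Rightarrow> real"
  assumes "open S" "x \<in> S" and f': "\<And>y. y \<in> S \<Longrightarrow> (f has_derivative f' y) (at y)"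
    and f'': "\<And>y v. y \<in> S \<Longrightarrow> ((\<lambda>y. f' y v) has_derivative f'' v y) (at y)"
    and cont: "\<And>u v. continuous_on S (\<lambda>y. f'' u y v)"
  shows "f'' u x v = f'' v x u"
proof (rule ccontr)
  assume ne: "f'' u x v \<noteq> f'' v x u"
  define \<epsilon> where "\<epsilon> = \<bar>f'' u x v - f'' v x u\<bar> / 2"
  have \<epsilon>: "\<epsilon> > 0" using ne by (simp add: \<epsilon>_def)
  have near: "\<exists>d>0. \<forall>y. dist y x < d \<longrightarrow> \<bar>f'' u y v - f'' u x v\<bar> < \<epsilon>" for u v
    using cont[of u v] assms(1,2) \<epsilon>
    by (metis continuous_on_eq_continuous_at continuous_at_eps_delta dist_real_def)
  obtain d1 where d1: "d1 > 0" "\<And>y. dist y x < d1 \<Longrightarrow> \<bar>f'' u y v - f'' u x v\<bar> < \<epsilon>" using near by blast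
  obtain d2 where d2: "d2 > 0" "\<And>y. dist y x < d2 \<Longrightarrow> \<bar>f'' v y u - f'' v x u\<bar> < \<epsilon>" using near by blast
  obtain d3 where d3: "d3 > 0" "ball x d3 \<subseteq> S" using assms(1,2) open_contains_ball by blast
  define d where "d = min d1 (min d2 d3)"
  define t where "t = d / (2 * (norm u + norm v + 1))"
  have d: "d > 0" using d1 d2 d3 by (simp add: d_def)
  have pos: "norm u + norm v + 1 > 0" by (simp add: add_nonneg_pos)
  have t: "t > 0" using d pos by (simp add: t_def)
  have close: "dist (x + r *\<^sub>R u + s *\<^sub>R v) x < d" if "r \<in> {0..t}" "s \<in> {0..t}" for r s
  proof -
    have "norm (r *\<^sub>R u + s *\<^sub>R v) \<le> t * norm u + t * norm v"
      using that by (intro order_trans[OF norm_triangle_ineq] add_mono) (auto intro: mult_right_mono)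
    also have "\<dots> \<le> t * (norm u + norm v + 1)" using t by (simp add: algebra_simps)
    also have "\<dots> = d / 2" using pos by (simp add: t_def field_simps)
    also have "\<dots> < d" using d by simp
    finally show ?thesis by (simp add: dist_norm add.assoc)
  qed
  have inS: "y \<in> S" if "dist y x < d" for y
    using that d3(2) by (auto simp: d_def dist_commute)
  have "\<exists>r\<in>{0..t}. \<exists>s\<in>{0..t}.
    f (x + t *\<^sub>R u + t *\<^sub>R v) - f (x + t *\<^sub>R u) - f (x + t *\<^sub>R v) + f x = t\<^sup>2 * f'' u (x + r *\<^sub>R u + s *\<^sub>R v) v"
    using close inS by (intro second_difference_mean_value[OF f' f'' _ t]) auto
  then obtain r s where rs: "r \<in> {0..t}" "s \<in> {0..t}"
    "f (x + t *\<^sub>R u + t *\<^sub>R v) - f (x + t *\<^sub>R u) - f (x + t *\<^sub>R v) + f x = t\<^sup>2 * f'' u (x + r *\<^sub>R u + s *\<^sub>R v) v"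
    by blast
  have sw: "x + r *\<^sub>R v + s *\<^sub>R u = x + s *\<^sub>R u + r *\<^sub>R v" for r s by simp
  have "\<exists>r\<in>{0..t}. \<exists>s\<in>{0..t}.
    f (x + t *\<^sub>R v + t *\<^sub>R u) - f (x + t *\<^sub>R v) - f (x + t *\<^sub>R u) + f x = t\<^sup>2 * f'' v (x + r *\<^sub>R v + s *\<^sub>R u) u"
    using close inS by (intro second_difference_mean_value[OF f' f'' _ t]) (auto simp: sw)
  then obtain r' s' where rs': "r' \<in> {0..t}" "s' \<in> {0..t}"
    "f (x + t *\<^sub>R u + t *\<^sub>R v) - f (x + t *\<^sub>R u) - f (x + t *\<^sub>R v) + f x = t\<^sup>2 * f'' v (x + s' *\<^sub>R u + r' *\<^sub>R v) u"
    by (auto simp: sw algebra_simps)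
  have "f'' u (x + r *\<^sub>R u + s *\<^sub>R v) v = f'' v (x + s' *\<^sub>R u + r' *\<^sub>R v) u"
    using rs(3) rs'(3) t by simp
  moreover have "\<bar>f'' u (x + r *\<^sub>R u + s *\<^sub>R v) v - f'' u x v\<bar> < \<epsilon>"
    using close[OF rs(1,2)] by (intro d1(2)) (simp add: d_def)
  moreover have "\<bar>f'' v (x + s' *\<^sub>R u + r' *\<^sub>R v) u - f'' v x u\<bar> < \<epsilon>"
    using close[OF rs'(2,1)] by (intro d2(2)) (simp add: d_def)
  moreover have "2 * \<epsilon> = \<bar>f'' u x v - f'' v x u\<bar>" by (simp add: \<epsilon>_def)
  ultimately show False by linarith
qed

section \<open>Orbits trapped near an unstable fixed point\<close>

lemma selfadjoint_finite_eigenvalues: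
  fixes B :: "'a::euclidean_space \<Rightarrow> 'a"
  assumes "linear B" and sym: "\<And>v w. B v \<bullet> w = v \<bullet> B w"
  shows "finite {s. \<exists>v. v \<noteq> 0 \<and> B v = s *\<^sub>R v}" (is "finite ?E")
proof -
  obtain ev where ev: "\<And>s. s \<in> ?E \<Longrightarrow> ev s \<noteq> 0 \<and> B (ev s) = s *\<^sub>R ev s"
    by (rule that[of "\<lambda>s. SOME v. v \<noteq> 0 \<and> B v = s *\<^sub>R v"]) (rule someI_ex, simp)
  have orth: "ev s \<bullet> ev t = 0" if "s \<in> ?E" "t \<in> ?E" "s \<noteq> t" for s t
  proof -
    have "s * (ev s \<bullet> ev t) = t * (ev s \<bullet> ev t)"
      using sym[of "ev s" "ev t"] ev[OF that(1)] ev[OF that(2)] by simp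
    then show ?thesis using that(3) by simp
  qed
  have inj: "inj_on ev ?E"
  proof (rule inj_onI, rule ccontr)
    fix s t assume st: "s \<in> ?E" "t \<in> ?E" "ev s = ev t" "s \<noteq> t"
    then show False using orth[of s t] ev[of t] by simp
  qed
  have "pairwise orthogonal (ev ` ?E)"
    unfolding pairwise_def orthogonal_def using orth by fast
  moreover have "0 \<notin> ev ` ?E" using ev by fastforce
  ultimately have "independent (ev ` ?E)" by (rule pairwise_orthogonal_independent)
  then have "finite (ev ` ?E)" by (rule independent_imp_finite)
  then show ?thesis using inj by (rule finite_imageD)
qed

lemma negligible_if_indefinite_form_nonpos:
  fixes A :: "'a::euclidean_space \<Rightarrow> 'a"
  assumes lin: "linear A" and sym: "\<And>v w. A v \<bullet> w = v \<bullet> A w"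
    and e: "norm e = 1" "A e = lam *\<^sub>R e" and s: "0 < s" "s < lam\<^sup>2"
    and S: "\<And>y z. \<lbrakk>y \<in> S; z \<in> S\<rbrakk> \<Longrightarrow> (norm (A (y - z)))\<^sup>2 \<le> s * (norm (y - z))\<^sup>2"
  shows "negligible S"
proof -
  define P where "P y = y - (y \<bullet> e) *\<^sub>R e" for y :: 'a
  define K where "K = sqrt (s / (lam\<^sup>2 - s) + 1)"
  have ee: "e \<bullet> e = 1" using e by (simp add: norm_eq_1)
  have Pe: "e \<bullet> P y = 0" for y
    by (simp add: P_def inner_diff_right ee inner_commute)
  have lip: "norm (y - z) \<le> K * norm (P y - P z)" if yz: "y \<in> S" "z \<in> S" for y z
  proof -
    define a where "a = (y - z) \<bullet> e"
    define w where "w = P y - P z"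
    have v: "y - z = a *\<^sub>R e + w"
      by (simp add: a_def w_def P_def algebra_simps)
    have ew: "e \<bullet> w = 0" using Pe by (simp add: w_def inner_diff_right)
    have eAw: "e \<bullet> A w = 0" using sym[of e w] e ew by simp
    have "A (y - z) = (a * lam) *\<^sub>R e + A w"
      by (simp add: v linear_add[OF lin] linear_scale[OF lin] e)
    then have n1: "(norm (A (y - z)))\<^sup>2 = a\<^sup>2 * lam\<^sup>2 + (norm (A w))\<^sup>2"
      by (simp add: power2_norm_eq_inner inner_add_left inner_add_right eAw inner_commute[of "A w" e] ee
          power_mult_distrib) (simp add: power2_eq_square)
    have n2: "(norm (y - z))\<^sup>2 = a\<^sup>2 + (norm w)\<^sup>2"
      by (simp add: v power2_norm_eq_inner inner_add_left inner_add_right ew inner_commute[of w e] ee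
          power_mult_distrib) (simp add: power2_eq_square)
    have "a\<^sup>2 * (lam\<^sup>2 - s) \<le> s * (norm w)\<^sup>2 - (norm (A w))\<^sup>2"
      using S[OF yz] unfolding n1 n2 by (simp add: algebra_simps)
    also have "\<dots> \<le> s * (norm w)\<^sup>2" by simp
    finally have "a\<^sup>2 \<le> s * (norm w)\<^sup>2 / (lam\<^sup>2 - s)" using s by (simp add: pos_le_divide_eq)
    then have "(norm (y - z))\<^sup>2 \<le> (s / (lam\<^sup>2 - s) + 1) * (norm w)\<^sup>2"
      unfolding n2 by (simp add: algebra_simps)
    then have "norm (y - z) \<le> sqrt ((s / (lam\<^sup>2 - s) + 1) * (norm w)\<^sup>2)"
      by (rule real_le_rsqrt)
    then show ?thesis by (simp add: K_def w_def real_sqrt_mult)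
  qed
  have inj: "inj_on P S"
    using lip by (intro inj_onI) force
  have "negligible {w. e \<bullet> w = 0}" using ee by (intro negligible_hyperplane) auto
  then have "negligible (P ` S)" by (rule negligible_subset) (auto simp: Pe)
  then have "negligible (inv_into S P ` (P ` S))"
  proof (rule negligible_locally_Lipschitz_image[OF order_refl], goal_cases)
    case (1 x)
    then show ?case
      using lip inj by (intro exI[of _ UNIV] exI[of _ K]) (auto)
  qed
  then show ?thesis using inj by (simp add: inj_on_image_eq_iff image_image)
qed

text \<open>For self-adjoint \<open>A\<close> the form \<open>Q v = (norm (A v))\<^sup>2 - s * (norm v)\<^sup>2\<close> satisfies
  \<open>Q (A v) = s * Q v + (norm (A (A v) - s *\<^sub>R v))\<^sup>2\<close>. If \<open>s > 1\<close> is not an eigenvalue of \<open>A\<^sup>2\<close>, the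
  last term is positive definite and absorbs the nonlinear error, so \<open>G\<close> expands \<open>Q\<close> on
  differences of points. Trapped points therefore have differences with \<open>Q \<le> 0\<close>, and they form
  a Lipschitz graph over the complement of the unstable direction. No invariant manifold has to be
  constructed.\<close>

lemma negligible_trapped_near_unstable_fixpoint:
  fixes G A :: "'a::euclidean_space \<Rightarrow> 'a"
  assumes lin: "linear A" and sym: "\<And>v w. A v \<bullet> w = v \<bullet> A w"
    and e: "e \<noteq> 0" "A e = lam *\<^sub>R e" "1 < lam\<^sup>2"
    and strict: "\<And>\<epsilon>. \<epsilon> > 0 \<Longrightarrow> \<exists>\<delta>>0. \<forall>y\<in>ball x \<delta>. \<forall>z\<in>ball x \<delta>.
                   norm (G y - G z - A (y - z)) \<le> \<epsilon> * norm (y - z)"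
  shows "\<exists>\<delta>>0. negligible {y. \<forall>t. (G ^^ t) y \<in> ball x \<delta>}"
proof -
  have linAA: "linear (\<lambda>v. A (A v))"
    using linear_compose[OF lin lin] by (simp add: o_def)
  have "finite {s. \<exists>v. v \<noteq> 0 \<and> A (A v) = s *\<^sub>R v}"
    by (rule selfadjoint_finite_eigenvalues[OF linAA]) (simp add: sym)
  moreover have "infinite {1<..<lam\<^sup>2}" using e(3) by (rule infinite_Ioo)
  ultimately have "\<not> {1<..<lam\<^sup>2} \<subseteq> {s. \<exists>v. v \<noteq> 0 \<and> A (A v) = s *\<^sub>R v}"
    using finite_subset by blast
  then obtain s where s: "1 < s" "s < lam\<^sup>2" and nev: "\<And>v. A (A v) = s *\<^sub>R v \<Longrightarrow> v = 0"
    unfolding subset_iff greaterThanLessThan_iff mem_Collect_eq by blast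
  define Q where "Q v = (norm (A v))\<^sup>2 - s * (norm v)\<^sup>2" for v
  define C where "C v = A (A v) - s *\<^sub>R v" for v
  have linC: "linear C" unfolding C_def
    by (intro linear_compose_sub linAA linear_scaleR)
  have "inj C"
    using nev by (simp add: linear_injective_0[OF linC]) (simp add: C_def)
  then obtain c where c: "c > 0" "\<And>v. c * norm v \<le> norm (C v)"
    using linear_inj_bounded_below_pos[OF linC] by blast
  obtain K where K: "K > 0" "\<And>v. norm (A v) \<le> K * norm v"
    using linear_bounded_pos[OF lin] by blast
  define N where "N = 2 * K * K * K + 2 * s * K + s"
  have N: "N > 0" using K(1) s unfolding N_def by (intro add_nonneg_pos) auto
  define \<epsilon> where "\<epsilon> = min 1 (c\<^sup>2 / N)"
  have \<epsilon>: "\<epsilon> > 0" "\<epsilon> \<le> 1" "\<epsilon> * N \<le> c\<^sup>2"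
    using N c(1) by (auto simp: \<epsilon>_def min_def field_simps)
  obtain \<delta> where \<delta>: "\<delta> > 0" and str: "\<And>y z. y \<in> ball x \<delta> \<Longrightarrow> z \<in> ball x \<delta> \<Longrightarrow>
                   norm (G y - G z - A (y - z)) \<le> \<epsilon> * norm (y - z)"
    using strict[OF \<epsilon>(1)] by blast
  have expand: "s * Q (y - z) \<le> Q (G y - G z)" if yz: "y \<in> ball x \<delta>" "z \<in> ball x \<delta>" for y z
  proof -
    define v where "v = y - z"
    define r where "r = G y - G z - A v"
    have r: "norm r \<le> \<epsilon> * norm v" using str[OF yz] by (simp add: r_def v_def)
    have nv: "0 \<le> norm v" by simp
    have *: "Q (A v + r) = Q (A v) + 2 * (A (A v) \<bullet> A r) - 2 * s * (A v \<bullet> r) + (norm (A r))\<^sup>2 - s * (norm r)\<^sup>2"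
      unfolding Q_def linear_add[OF lin] power2_norm_eq_inner
      by (simp add: inner_add_left inner_add_right inner_commute algebra_simps)
    have QA: "Q (A v) = s * Q v + (norm (C v))\<^sup>2"
      unfolding Q_def C_def power2_norm_eq_inner
      using sym[of "A v" v] by (simp add: inner_diff_left inner_diff_right inner_commute algebra_simps)
    have Ar: "norm (A r) \<le> K * (\<epsilon> * norm v)"
      using K(2)[of r] r K(1) by (meson mult_le_cancel_left_pos order_trans)
    have AA: "norm (A (A v)) \<le> K * (K * norm v)"
      using K(2)[of "A v"] K(2)[of v] K(1) by (meson mult_le_cancel_left_pos order_trans)
    have "\<bar>A (A v) \<bullet> A r\<bar> \<le> norm (A (A v)) * norm (A r)" by (rule Cauchy_Schwarz_ineq2)
    also have "\<dots> \<le> (K * (K * norm v)) * (K * (\<epsilon> * norm v))"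
      using AA Ar K(1) by (intro mult_mono) auto
    finally have b1: "\<bar>A (A v) \<bullet> A r\<bar> \<le> \<epsilon> * (K * K * K) * (norm v)\<^sup>2"
      by (simp add: power2_eq_square mult_ac)
    have "\<bar>A v \<bullet> r\<bar> \<le> norm (A v) * norm r" by (rule Cauchy_Schwarz_ineq2)
    also have "\<dots> \<le> (K * norm v) * (\<epsilon> * norm v)"
      using K r by (intro mult_mono) auto
    finally have "s * \<bar>A v \<bullet> r\<bar> \<le> s * (\<epsilon> * K * (norm v)\<^sup>2)"
      using s by (intro mult_left_mono) (auto simp: power2_eq_square mult_ac)
    then have b2: "s * (A v \<bullet> r) \<le> s * (\<epsilon> * K * (norm v)\<^sup>2)"
      using s by (smt (verit) mult_left_mono)
    have "(norm r)\<^sup>2 \<le> (\<epsilon> * norm v)\<^sup>2" using r by (intro power_mono) auto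
    also have "\<dots> = \<epsilon> * (\<epsilon> * (norm v)\<^sup>2)" by (simp add: power2_eq_square mult_ac)
    also have "\<dots> \<le> \<epsilon> * (norm v)\<^sup>2"
      using \<epsilon> by (intro mult_left_mono mult_left_le_one_le) auto
    finally have b3: "s * (norm r)\<^sup>2 \<le> s * (\<epsilon> * (norm v)\<^sup>2)" using s by (intro mult_left_mono) auto
    have "(c * norm v)\<^sup>2 \<le> (norm (C v))\<^sup>2" using c by (intro power_mono) auto
    then have b4: "c\<^sup>2 * (norm v)\<^sup>2 \<le> (norm (C v))\<^sup>2" by (simp add: power_mult_distrib)
    have b5: "\<epsilon> * N * (norm v)\<^sup>2 \<le> c\<^sup>2 * (norm v)\<^sup>2" using \<epsilon>(3) by (intro mult_right_mono) auto
    have "\<epsilon> * N * (norm v)\<^sup>2 =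
        2 * (\<epsilon> * (K * K * K) * (norm v)\<^sup>2) + 2 * (s * (\<epsilon> * K * (norm v)\<^sup>2)) + s * (\<epsilon> * (norm v)\<^sup>2)"
      by (simp add: N_def algebra_simps)
    moreover have "- (\<epsilon> * (K * K * K) * (norm v)\<^sup>2) \<le> A (A v) \<bullet> A r" using b1 by linarith
    moreover have "0 \<le> (norm (A r))\<^sup>2" by simp
    ultimately have "s * Q v \<le> Q (A v + r)"
      unfolding * QA using b2 b3 b4 b5 by linarith
    moreover have "A v + r = G y - G z" by (simp add: r_def)
    ultimately show ?thesis by (simp add: v_def)
  qed
  define S where "S = {y. \<forall>t. (G ^^ t) y \<in> ball x \<delta>}"
  define e1 where "e1 = e /\<^sub>R norm e"
  have e1: "norm e1 = 1" "A e1 = lam *\<^sub>R e1"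
    using e by (simp_all add: e1_def linear_scale[OF lin])
  have "negligible S"
  proof (rule negligible_if_indefinite_form_nonpos[OF lin sym e1])
    fix y z assume yz: "y \<in> S" "z \<in> S"
    have iter: "s ^ t * Q (y - z) \<le> Q ((G ^^ t) y - (G ^^ t) z)" for t
    proof (induction t)
      case (Suc t)
      have "s ^ Suc t * Q (y - z) \<le> s * Q ((G ^^ t) y - (G ^^ t) z)"
        using Suc s by simp
      also have "\<dots> \<le> Q ((G ^^ Suc t) y - (G ^^ Suc t) z)"
        using expand[of "(G ^^ t) y" "(G ^^ t) z"] yz by (simp add: S_def)
      finally show ?case .
    qed simp
    have bound: "Q ((G ^^ t) y - (G ^^ t) z) \<le> (K * (2 * \<delta>))\<^sup>2" for t
    proof -
      let ?v = "(G ^^ t) y - (G ^^ t) z"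
      have "dist x ((G ^^ t) y) < \<delta>" "dist x ((G ^^ t) z) < \<delta>" using yz by (auto simp: S_def)
      then have "norm ?v \<le> 2 * \<delta>" 
        using dist_triangle3[of "(G ^^ t) y" "(G ^^ t) z" x] by (simp add: dist_norm)
      then have "norm (A ?v) \<le> K * (2 * \<delta>)"
        using K(2)[of ?v] K(1) by (meson mult_le_cancel_left_pos order_trans)
      then have "(norm (A ?v))\<^sup>2 \<le> (K * (2 * \<delta>))\<^sup>2" by (intro power_mono) auto
      moreover have "0 \<le> s * (norm ?v)\<^sup>2" using s by simp
      ultimately show ?thesis unfolding Q_def by linarith
    qed
    have "Q (y - z) \<le> 0"
    proof (rule ccontr)
      assume "\<not> Q (y - z) \<le> 0"
      then have q: "Q (y - z) > 0" by simp
      obtain t where "(K * (2 * \<delta>))\<^sup>2 / Q (y - z) < s ^ t"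
        using real_arch_pow[OF s(1)] by blast
      then have "(K * (2 * \<delta>))\<^sup>2 < s ^ t * Q (y - z)" using q by (simp add: pos_divide_less_eq)
      then show False using iter[of t] bound[of t] by linarith
    qed
    then show "(norm (A (y - z)))\<^sup>2 \<le> s * (norm (y - z))\<^sup>2" by (simp add: Q_def)
  qed (use s in auto)
  then show ?thesis using \<delta> unfolding S_def by blast
qed

section \<open>Geometry of products of spheres\<close>

lemma tangent_derivative_unique:
  assumes "(f has_derivative D) (at x within M)" "(f has_derivative D') (at x within M)"
    and "u \<in> tangent_space M x"
  shows "D u = D' u"
proof -
  obtain c \<epsilon> where c: "\<epsilon> > 0" "\<forall>t\<in>{-\<epsilon><..<\<epsilon>}. c t \<in> M" "c 0 = x" "(c has_vector_derivative u) (at 0)"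
    using assms(3) unfolding tangent_space_def by blast
  have c': "(c has_derivative (\<lambda>h. h *\<^sub>R u)) (at 0 within {-\<epsilon><..<\<epsilon>})"
    using c(4) by (simp add: has_vector_derivative_def has_derivative_at_withinI)
  have "((\<lambda>t. f (c t)) has_derivative (\<lambda>h. E (h *\<^sub>R u))) (at 0)"
    if "(f has_derivative E) (at x within M)" for E
  proof -
    have "(f has_derivative E) (at (c 0) within c ` {-\<epsilon><..<\<epsilon>})"
      using that c(2,3) by (auto intro: has_derivative_subset)
    from has_derivative_in_compose[OF c' this] show ?thesis
      using c(1) by (simp add: at_within_open[OF _ open_greaterThanLessThan])
  qed
  from has_derivative_unique[OF this[OF assms(1)] this[OF assms(2)]]
  show ?thesis by (metis scaleR_one)
qed

lemma differential_on_eq: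
  assumes "(f has_derivative D) (at x within M)" "u \<in> tangent_space M x"
  shows "differential_on M f x u = D u"
proof -
  have "(f has_derivative frechet_derivative f (at x within M)) (at x within M)"
    using assms(1) differentiableI frechet_derivative_works by blast
  from tangent_derivative_unique[OF this assms] show ?thesis
    by (simp add: differential_on_def)
qed

lemma Cn_on_vecI:
  fixes f :: "'a::euclidean_space \<Rightarrow> real ^ 'n"
  assumes "\<And>i. Cn_on n (\<lambda>x. f x $ i) S"
  shows "Cn_on n f S"
proof -
  have "Cn_on n (\<lambda>x. \<Sum>i\<in>UNIV. (f x $ i) *\<^sub>R (axis i 1 :: real ^ 'n)) S"
    by (intro Cn_on_sum Cn_on_scaleR assms Cn_on_const)
  moreover have "(\<lambda>x. \<Sum>i\<in>UNIV. (f x $ i) *\<^sub>R axis i 1) = f"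
    by (auto simp: vec_eq_iff axis_def if_distrib cong: if_cong)
  ultimately show ?thesis by (simp only:)
qed

lemma Cn_on_trig:
  fixes w :: real
  shows "Cn_on n (\<lambda>t::real. cos (w * t) * p + sin (w * t) * q) S"
proof (induction n arbitrary: p q)
  case 0
  then show ?case by (auto intro!: continuous_intros)
next
  case (Suc n)
  have "((\<lambda>t. cos (w * t) * p + sin (w * t) * q) has_derivative
      (\<lambda>v. cos (w * t) * (v * w * q) + sin (w * t) * (- v * w * p))) (at t)" for t
    by (auto intro!: derivative_eq_intros simp: algebra_simps)
  then show ?case unfolding Cn_on.simps using Suc
    by (intro exI[of _ "\<lambda>t v. cos (w * t) * (v * w * q) + sin (w * t) * (- v * w * p)"]) blast
qed

definition block_inner :: "('n::finite \<Rightarrow> 'k) \<Rightarrow> 'k \<Rightarrow> real ^ 'n \<Rightarrow> real ^ 'n \<Rightarrow> real" where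
  "block_inner b k x y = (\<Sum>i\<in>b -` {k}. x $ i * y $ i)"

definition block_scale :: "('n::finite \<Rightarrow> 'k) \<Rightarrow> ('k \<Rightarrow> real) \<Rightarrow> real ^ 'n \<Rightarrow> real ^ 'n" where
  "block_scale b c x = (\<chi> i. c (b i) * x $ i)"

definition nonzero_blocks :: "('n::finite \<Rightarrow> 'k) \<Rightarrow> (real ^ 'n) set" where
  "nonzero_blocks b = {x. \<forall>k. 0 < block_inner b k x x}"

definition block_normalize :: "('n::finite \<Rightarrow> 'k) \<Rightarrow> real ^ 'n \<Rightarrow> real ^ 'n" where
  "block_normalize b x = block_scale b (\<lambda>k. block_inner b k x x powr (- 1 / 2)) x"

lemma inner_block_inner:
  fixes b :: "'n::finite \<Rightarrow> 'k::finite"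
  shows "x \<bullet> y = (\<Sum>k\<in>UNIV. block_inner b k x y)"
  unfolding inner_vec_def block_inner_def
  using sum.group[of UNIV UNIV b "\<lambda>i. x $ i * y $ i"] by (simp add: vimage_def)

lemma bounded_bilinear_block_inner: "bounded_bilinear (block_inner b k)"
proof
  show "\<exists>K. \<forall>x y. norm (block_inner b k x y) \<le> norm x * norm y * K"
  proof (intro exI allI)
    fix x y :: "real ^ 'a"
    have "norm (block_inner b k x y) \<le> (\<Sum>i\<in>b -` {k}. norm x * norm y)"
      unfolding block_inner_def
      by (rule sum_norm_le) (auto simp: abs_mult intro!: mult_mono component_le_norm_cart)
    then show "norm (block_inner b k x y) \<le> norm x * norm y * real (card (b -` {k}))"
      by (simp add: mult.commute)
  qed
qed (simp_all add: block_inner_def sum.distrib algebra_simps sum_distrib_left)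

lemmas block_inner_simps =
  bounded_bilinear.add_left[OF bounded_bilinear_block_inner]
  bounded_bilinear.add_right[OF bounded_bilinear_block_inner]
  bounded_bilinear.diff_left[OF bounded_bilinear_block_inner]
  bounded_bilinear.diff_right[OF bounded_bilinear_block_inner]
  bounded_bilinear.scaleR_left[OF bounded_bilinear_block_inner]
  bounded_bilinear.scaleR_right[OF bounded_bilinear_block_inner]

lemma block_inner_zero [simp]: "block_inner b k 0 y = 0" "block_inner b k x 0 = 0"
  by (simp_all add: block_inner_def)

lemma block_inner_commute: "block_inner b k x y = block_inner b k y x"
  by (simp add: block_inner_def mult.commute)

lemma block_inner_scale [simp]:
  "block_inner b k (block_scale b c x) y = c k * block_inner b k x y"
  "block_inner b k x (block_scale b c y) = c k * block_inner b k x y"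
  by (auto simp: block_inner_def block_scale_def sum_distrib_left algebra_simps intro!: sum.cong)

lemma block_inner_nonneg [simp]: "0 \<le> block_inner b k x x"
  by (simp add: block_inner_def sum_nonneg)

lemma block_inner_eq_0D: "block_inner b (b i) x x = 0 \<Longrightarrow> x $ i = 0"
  by (simp add: block_inner_def sum_nonneg_eq_0_iff)

lemma block_scale_scale [simp]: "block_scale b c (block_scale b c' x) = block_scale b (\<lambda>k. c k * c' k) x"
  by (simp add: block_scale_def vec_eq_iff)

lemma block_scale_one [simp]: "block_scale b (\<lambda>k. 1) x = x"
  by (simp add: block_scale_def vec_eq_iff)

lemma block_scale_inverse:
  assumes "\<And>k. c k \<noteq> 0"
  shows "block_scale b c (block_scale b (\<lambda>k. inverse (c k)) x) = x"
    and "block_scale b (\<lambda>k. inverse (c k)) (block_scale b c x) = x"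
  using assms by simp_all

lemma bounded_linear_block_scale: "bounded_linear (block_scale b c)"
  by (rule linear_conv_bounded_linear[THEN iffD1], rule linearI)
    (simp_all add: block_scale_def vec_eq_iff algebra_simps)

lemma bij_block_scale: "(\<And>k. c k \<noteq> 0) \<Longrightarrow> bij (block_scale b c)"
  by (rule bij_betw_byWitness[where f' = "block_scale b (\<lambda>k. inverse (c k))"]) auto

lemma powr_minus_half_mult: "0 < r \<Longrightarrow> (r powr (- 1 / 2)) * (r powr (- 1 / 2)) * r = (1::real)"
  by (simp add: powr_minus powr_half_sqrt field_simps)

lemma block_normalize_scale:
  assumes "\<And>k. 0 < c k" "x \<in> nonzero_blocks b"
  shows "block_normalize b (block_scale b c x) = block_normalize b x"
proof -
  have "(c k * (c k * block_inner b k x x)) powr (- 1 / 2) * c k = block_inner b k x x powr (- 1 / 2)" for k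
  proof -
    have "(c k * (c k * block_inner b k x x)) powr (- 1 / 2) =
        (c k * c k) powr (- 1 / 2) * block_inner b k x x powr (- 1 / 2)"
      using assms(1)[of k] by (simp add: powr_mult)
    also have "(c k * c k) powr (- 1 / 2) = inverse (c k)"
      using assms(1)[of k] by (simp add: powr_minus powr_half_sqrt)
    finally show ?thesis using assms(1)[of k] by simp
  qed
  then show ?thesis by (simp add: block_normalize_def)
qed

context
  fixes b :: "'n::finite \<Rightarrow> 'k::finite"
begin

lemma open_nonzero_blocks: "open (nonzero_blocks b)"
  unfolding nonzero_blocks_def Collect_all_eq block_inner_def
  by (intro open_INT finite ballI open_Collect_less continuous_intros)

lemma sphere_product_iff: "x \<in> sphere_product b \<longleftrightarrow> (\<forall>k. block_inner b k x x = 1)"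
  by (simp add: sphere_product_def L2_set_def block_inner_def power2_eq_square)

lemma sphere_product_subset: "sphere_product b \<subseteq> nonzero_blocks b"
  by (auto simp: sphere_product_iff nonzero_blocks_def)

lemma block_scale_nonzero_blocks:
  "(\<And>k. c k \<noteq> 0) \<Longrightarrow> x \<in> nonzero_blocks b \<Longrightarrow> block_scale b c x \<in> nonzero_blocks b"
  by (auto simp: nonzero_blocks_def power2_eq_square[symmetric] mult.assoc[symmetric] intro!: mult_pos_pos)

lemma block_normalize_in: "x \<in> nonzero_blocks b \<Longrightarrow> block_normalize b x \<in> sphere_product b"
  using powr_minus_half_mult by (auto simp: sphere_product_iff block_normalize_def nonzero_blocks_def mult.assoc)

lemma block_normalize_sphere: "x \<in> sphere_product b \<Longrightarrow> block_normalize b x = x"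
  by (simp add: sphere_product_iff block_normalize_def)

lemma block_scale_normalize:
  assumes "x \<in> nonzero_blocks b"
  shows "block_scale b (\<lambda>k. sqrt (block_inner b k x x)) (block_normalize b x) = x"
proof -
  have "sqrt r * r powr (- 1 / 2) = 1" if "0 < r" for r :: real
    using that by (simp add: powr_minus powr_half_sqrt)
  then show ?thesis using assms
    by (simp add: block_normalize_def nonzero_blocks_def)
qed

lemma Cn_on_block_inner:
  "Cn_on n f S \<Longrightarrow> Cn_on n g S \<Longrightarrow> Cn_on n (\<lambda>x. block_inner b k (f x) (g x)) S"
  unfolding block_inner_def
  by (intro Cn_on_sum Cn_on_mult Cn_on_linear_compose[OF bounded_linear_vec_nth])

lemma Cn_on_block_normalize: "Cn_on n (block_normalize b) (nonzero_blocks b)"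
  unfolding block_normalize_def
  by (rule Cn_on_vecI) (auto simp: block_scale_def nonzero_blocks_def
      intro!: Cn_on_mult Cn_on_powr_compose Cn_on_block_inner Cn_on_linear_compose[OF bounded_linear_vec_nth])

lemma tangent_space_sphere_product:
  assumes x: "x \<in> sphere_product b"
  shows "tangent_space (sphere_product b) x = {v. \<forall>k. block_inner b k x v = 0}"
proof (intro equalityI subsetI)
  fix v assume "v \<in> tangent_space (sphere_product b) x"
  then obtain c \<epsilon> where c: "\<epsilon> > 0" "\<forall>t\<in>{-\<epsilon><..<\<epsilon>}. c t \<in> sphere_product b" "c 0 = x"
      "(c has_vector_derivative v) (at 0)"
    unfolding tangent_space_def by blast
  have "block_inner b k x v = 0" for k
  proof -
    have c': "(c has_derivative (\<lambda>h. h *\<^sub>R v)) (at 0)"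
      using c(4) by (simp add: has_vector_derivative_def)
    have "((\<lambda>t. block_inner b k (c t) (c t)) has_derivative
        (\<lambda>h. block_inner b k x (h *\<^sub>R v) + block_inner b k (h *\<^sub>R v) x)) (at 0)"
      using bounded_bilinear.FDERIV[OF bounded_bilinear_block_inner c' c'] c(3) by simp
    moreover have "((\<lambda>t. block_inner b k (c t) (c t)) has_derivative (\<lambda>h. 0)) (at 0)"
    proof (rule has_derivative_transform_within_open[OF has_derivative_const])
      show "1 = block_inner b k (c t) (c t)" if "t \<in> {-\<epsilon><..<\<epsilon>}" for t
        using c(2) that by (simp add: sphere_product_iff)
    qed (use c(1) in auto)
    ultimately have "(\<lambda>h. block_inner b k x (h *\<^sub>R v) + block_inner b k (h *\<^sub>R v) x) = (\<lambda>h. 0)"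
      by (rule has_derivative_unique)
    from fun_cong[OF this, of 1] show ?thesis by (simp add: block_inner_commute)
  qed
  then show "v \<in> {v. \<forall>k. block_inner b k x v = 0}" by simp
next
  fix v assume "v \<in> {v. \<forall>k. block_inner b k x v = 0}"
  then have v: "block_inner b k x v = 0" for k by simp
  define w where "w k = sqrt (block_inner b k v v)" for k
  have ww: "block_inner b k v v = w k * w k" for k by (simp add: w_def)
  define u where "u = block_scale b (\<lambda>k. inverse (w k)) v"
  define c where "c t = block_scale b (\<lambda>k. cos (w k * t)) x + block_scale b (\<lambda>k. sin (w k * t)) u" for t
  have "Ck_on \<infinity> c {-1<..<1}"
    unfolding Ck_on_def c_def block_scale_def
    by (auto intro!: Cn_on_vecI Cn_on_trig)
  moreover have "c t \<in> sphere_product b" for t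
    unfolding sphere_product_iff
  proof
    fix k
    have "block_inner b k (c t) (c t) = (cos (w k * t))\<^sup>2 + (sin (w k * t))\<^sup>2 * block_inner b k u u"
      using x v by (simp add: c_def block_inner_simps u_def block_inner_commute[of b k v x]
          sphere_product_iff power2_eq_square)
    also have "(sin (w k * t))\<^sup>2 * block_inner b k u u = (sin (w k * t))\<^sup>2"
      by (cases "w k = 0") (simp_all add: u_def ww field_simps)
    finally show "block_inner b k (c t) (c t) = 1" by simp
  qed
  moreover have "c 0 = x" by (simp add: c_def block_scale_def vec_eq_iff)
  moreover have "(c has_vector_derivative v) (at 0)"
  proof -
    have "w (b i) * u $ i = v $ i" for i
      using block_inner_eq_0D[of b i v] ww[of "b i"]
      by (cases "w (b i) = 0") (simp_all add: u_def block_scale_def)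
    then have "((\<lambda>t. c t $ i) has_derivative (\<lambda>h. h * v $ i)) (at 0)" for i
      unfolding c_def block_scale_def
      by (auto intro!: derivative_eq_intros simp: algebra_simps)
    then have "(c has_derivative (\<lambda>h. h *\<^sub>R v)) (at 0)"
      by (subst has_derivative_componentwise_within) (auto simp: Basis_vec_def cart_eq_inner_axis[symmetric] inner_axis)
    then show ?thesis by (simp add: has_vector_derivative_def)
  qed
  ultimately show "v \<in> tangent_space (sphere_product b) x"
    unfolding tangent_space_def by (blast intro: zero_less_one)
qed

lemma closest_point_sphere_product:
  assumes y: "y \<in> nonzero_blocks b"
  shows "closest_point (sphere_product b) y = block_normalize b y"
proof -
  define q where "q = block_normalize b y"
  define r where "r k = sqrt (block_inner b k y y)" for k
  have q: "q \<in> sphere_product b" using block_normalize_in[OF y] by (simp add: q_def)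
  have yq: "y = block_scale b r q" using block_scale_normalize[OF y] by (simp add: q_def r_def[abs_def])
  have r: "r k > 0" for k using y by (simp add: r_def nonzero_blocks_def)
  have id: "(dist y z)\<^sup>2 = (dist y q)\<^sup>2 + (\<Sum>k\<in>UNIV. r k * block_inner b k (z - q) (z - q))"
    if z: "z \<in> sphere_product b" for z
    unfolding dist_norm power2_norm_eq_inner inner_block_inner[of _ _ b] sum.distrib[symmetric]
    using z q by (intro sum.cong) (simp_all add: yq block_inner_simps sphere_product_iff
        block_inner_commute[of b _ z q] algebra_simps)
  have ge: "0 \<le> (\<Sum>k\<in>UNIV. r k * block_inner b k (z - q) (z - q))" for z
    using r by (intro sum_nonneg mult_nonneg_nonneg) (auto intro: less_imp_le)
  have le: "dist y q \<le> dist y z" if "z \<in> sphere_product b" for z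
  proof -
    have "(dist y q)\<^sup>2 \<le> (dist y z)\<^sup>2" using id[OF that] ge[of z] by linarith
    then show ?thesis by (rule power2_le_imp_le) simp
  qed
  have uniq: "z = q" if "z \<in> sphere_product b" "dist y z \<le> dist y q" for z
  proof -
    have "(dist y z)\<^sup>2 \<le> (dist y q)\<^sup>2" using that(2) by (intro power_mono) auto
    then have "(\<Sum>k\<in>UNIV. r k * block_inner b k (z - q) (z - q)) = 0"
      using id[OF that(1)] ge[of z] by linarith
    then have "block_inner b k (z - q) (z - q) = 0" for k
      using less_imp_le[OF r] less_imp_neq[OF r, symmetric]
      by (subst (asm) sum_nonneg_eq_0_iff) auto
    then have "(z - q) $ i = 0" for i by (intro block_inner_eq_0D) 
    then show ?thesis by (simp add: vec_eq_iff)
  qed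
  show ?thesis
    unfolding closest_point_def q_def[symmetric]
  proof (rule some_equality)
    show "q \<in> sphere_product b \<and> (\<forall>z\<in>sphere_product b. dist y q \<le> dist y z)"
      using q le by blast
    fix z assume "z \<in> sphere_product b \<and> (\<forall>z'\<in>sphere_product b. dist y z \<le> dist y z')"
    then show "z = q" using q uniq by blast
  qed
qed

end

section \<open>The homogeneous extension\<close>

lemma block_inner_axis_sum:
  fixes b :: "'n::finite \<Rightarrow> 'k::finite"
  shows "x \<bullet> block_scale b (\<lambda>j. if j = k then 1 else 0) y = block_inner b k x y"
  by (simp add: inner_block_inner[of _ _ b] if_distrib[of "\<lambda>c. c * _"] cong: if_cong)

locale sphere_product_function =
  fixes b :: "'n::finite \<Rightarrow> 'k::finite" and f :: "real ^ 'n \<Rightarrow> real"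
  assumes C2: "Ck_on_submanifold 2 f (sphere_product b)"
begin

abbreviation "M \<equiv> sphere_product b"
abbreviation "\<Omega> \<equiv> nonzero_blocks b"

text \<open>The gradient of the blockwise homogeneous extension of \<open>f\<close> is tangential, so on \<open>M\<close> it is
  the Riemannian gradient.\<close>

definition f_ext :: "real ^ 'n \<Rightarrow> real" where
  "f_ext y = f (block_normalize b y)"

definition h :: "real ^ 'n \<Rightarrow> real ^ 'n" where
  "h y = (\<chi> i. frechet_derivative f_ext (at y) (axis i 1))"

definition H :: "real ^ 'n \<Rightarrow> real ^ 'n \<Rightarrow> real ^ 'n" where
  "H y = frechet_derivative h (at y)"

lemma M_subset: "x \<in> M \<Longrightarrow> x \<in> \<Omega>"
  using sphere_product_subset by blast

lemma Cn_on_f_ext: "Cn_on 2 f_ext \<Omega>"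
proof (rule Cn_on_locally)
  fix y assume y: "y \<in> \<Omega>"
  obtain V F where V: "open V" "block_normalize b y \<in> V" "Ck_on 2 F V" "\<forall>z\<in>V \<inter> M. F z = f z"
    using C2 block_normalize_in[OF y] unfolding Ck_on_submanifold_def by blast
  define W where "W = block_normalize b -` V \<inter> \<Omega>"
  have "continuous_on \<Omega> (block_normalize b)"
    using Cn_on_block_normalize by (rule Cn_on_imp_continuous_on)
  then have W: "open W" unfolding W_def
    using V(1) open_nonzero_blocks by (metis continuous_on_open_vimage Int_commute)
  have "Cn_on 2 F V" using V(3) by (simp add: Ck_on_def numeral_eq_enat)
  then have "Cn_on 2 (\<lambda>z. F (block_normalize b z)) W"
    by (rule Cn_on_compose) (auto simp: W_def intro: Cn_on_subset[OF Cn_on_block_normalize])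
  then have "Cn_on 2 f_ext W"
    by (rule Cn_on_cong[OF _ W]) (use V(4) block_normalize_in in \<open>auto simp: W_def f_ext_def\<close>)
  then show "\<exists>W. open W \<and> y \<in> W \<and> Cn_on 2 f_ext W" using W y V(2) by (auto simp: W_def)
qed

lemma f_ext_gradient:
  shows "\<And>y. y \<in> \<Omega> \<Longrightarrow> (f_ext has_derivative (\<lambda>v. h y \<bullet> v)) (at y)" and "Cn_on 1 h \<Omega>"
proof -
  obtain f' where f': "\<forall>x\<in>\<Omega>. (f_ext has_derivative f' x) (at x)" "\<forall>v. Cn_on 1 (\<lambda>x. f' x v) \<Omega>"
    using Cn_on_f_ext unfolding numeral_2_eq_2 Cn_on.simps(2)[of "Suc 0"] by auto
  have hi: "h y $ i = f' y (axis i 1)" if "y \<in> \<Omega>" for y i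
    using frechet_derivative_at[OF bspec[OF f'(1) that]] by (simp add: h_def)
  have "Cn_on 1 (\<lambda>y. h y $ i) \<Omega>" for i
    by (rule Cn_on_cong[OF spec[OF f'(2), of "axis i 1"] open_nonzero_blocks]) (simp add: hi)
  then show "Cn_on 1 h \<Omega>" by (rule Cn_on_vecI)
  fix y assume y: "y \<in> \<Omega>"
  have lin: "linear (f' y)" using f'(1) y has_derivative_linear by blast
  have "f' y v = h y \<bullet> v" for v
  proof -
    have "v = (\<Sum>i\<in>UNIV. (v $ i) *\<^sub>R axis i 1)"
      by (simp add: vec_eq_iff axis_def if_distrib cong: if_cong)
    then have "f' y v = f' y (\<Sum>i\<in>UNIV. (v $ i) *\<^sub>R axis i 1)" by (rule arg_cong)
    also have "\<dots> = (\<Sum>i\<in>UNIV. (v $ i) * h y $ i)"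
      by (simp add: linear_sum[OF lin] linear_scale[OF lin] hi[OF y])
    finally show ?thesis by (simp add: inner_vec_def mult.commute)
  qed
  then show "(f_ext has_derivative (\<lambda>v. h y \<bullet> v)) (at y)" using f'(1) y by (metis ext)
qed

lemma h_deriv: "y \<in> \<Omega> \<Longrightarrow> (h has_derivative H y) (at y)"
  and H_cont: "continuous_on \<Omega> (\<lambda>y. H y v)"
proof -
  obtain h' where h': "\<forall>x\<in>\<Omega>. (h has_derivative h' x) (at x)" "\<forall>v. continuous_on \<Omega> (\<lambda>x. h' x v)"
    using f_ext_gradient(2) by auto
  have "H y = h' y" if "y \<in> \<Omega>" for y using h' that frechet_derivative_at by (force simp: H_def)
  then show "y \<in> \<Omega> \<Longrightarrow> (h has_derivative H y) (at y)" "continuous_on \<Omega> (\<lambda>y. H y v)"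
    using h' by (auto cong: continuous_on_cong)
qed

lemma H_sym:
  assumes y: "y \<in> \<Omega>"
  shows "H y v \<bullet> w = v \<bullet> H y w"
proof -
  have "H y v \<bullet> w = H y w \<bullet> v"
  proof (rule second_derivative_symmetric[OF open_nonzero_blocks y f_ext_gradient(1),
        where f'' = "\<lambda>v y u. H y u \<bullet> v"])
    show "((\<lambda>y. h y \<bullet> v) has_derivative (\<lambda>u. H y u \<bullet> v)) (at y)" if "y \<in> \<Omega>" for y v
      using h_deriv[OF that] by (rule has_derivative_inner_left)
    show "continuous_on \<Omega> (\<lambda>y. H y v \<bullet> u)" for u v
      by (intro continuous_intros H_cont)
  qed
  then show ?thesis by (simp add: inner_commute)
qed

lemma h_scale:
  assumes c: "\<And>k. 0 < c k" and y: "y \<in> \<Omega>"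
  shows "h (block_scale b c y) = block_scale b (\<lambda>k. inverse (c k)) (h y)"
proof -
  have cy: "block_scale b c y \<in> \<Omega>"
    using c y by (intro block_scale_nonzero_blocks) (auto simp: less_imp_neq[symmetric])
  have "((\<lambda>z. f_ext (block_scale b c z)) has_derivative (\<lambda>v. h (block_scale b c y) \<bullet> block_scale b c v)) (at y)"
    by (rule has_derivative_compose[OF bounded_linear_imp_has_derivative[OF bounded_linear_block_scale]
          f_ext_gradient(1)[OF cy]])
  moreover have "((\<lambda>z. f_ext (block_scale b c z)) has_derivative (\<lambda>v. h y \<bullet> v)) (at y)"
    using f_ext_gradient(1)[OF y] open_nonzero_blocks y
    by (rule has_derivative_transform_within_open) (simp add: f_ext_def block_normalize_scale c)
  ultimately have "(\<lambda>v. h (block_scale b c y) \<bullet> block_scale b c v) = (\<lambda>v. h y \<bullet> v)"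
    by (rule has_derivative_unique)
  then have "h (block_scale b c y) \<bullet> block_scale b c v = h y \<bullet> v" for v by metis
  moreover have "h (block_scale b c y) \<bullet> block_scale b c v = block_scale b c (h (block_scale b c y)) \<bullet> v" for v
    by (simp add: inner_block_inner[of _ _ b])
  ultimately have "block_scale b c (h (block_scale b c y)) = h y"
    by (metis vector_eq_ldot inner_commute)
  then show ?thesis using block_scale_inverse(2)[of c b "h (block_scale b c y)"] c
    by (auto simp: less_imp_neq[symmetric])
qed

lemma h_radial:
  assumes y: "y \<in> \<Omega>"
  shows "block_inner b k y (h y) = 0"
proof -
  define z where "z = block_scale b (\<lambda>j. if j = k then 1 else 0) y"
  have l: "((\<lambda>t. y + t *\<^sub>R z) has_derivative (\<lambda>t. t *\<^sub>R z)) (at 0)"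
    by (auto intro!: derivative_eq_intros)
  have yz: "y + t *\<^sub>R z = block_scale b (\<lambda>j. if j = k then 1 + t else 1) y" for t
    by (simp add: z_def block_scale_def vec_eq_iff algebra_simps)
  have "((\<lambda>t. f_ext (y + t *\<^sub>R z)) has_derivative (\<lambda>t. h y \<bullet> (t *\<^sub>R z))) (at 0)"
    using has_derivative_compose[OF l, of f_ext "\<lambda>v. h y \<bullet> v"] f_ext_gradient(1)[OF y] by simp
  moreover have "((\<lambda>t. f_ext (y + t *\<^sub>R z)) has_derivative (\<lambda>t. 0)) (at 0)"
  proof (rule has_derivative_transform_within_open[OF has_derivative_const])
    show "f_ext y = f_ext (y + t *\<^sub>R z)" if "t \<in> {-1<..<1}" for t
      unfolding yz f_ext_def using y that by (subst block_normalize_scale) auto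
  qed auto
  ultimately have "(\<lambda>t. h y \<bullet> (t *\<^sub>R z)) = (\<lambda>t. 0)" by (rule has_derivative_unique)
  then have "h y \<bullet> z = 0" by (metis scaleR_one)
  then show ?thesis by (simp add: z_def block_inner_axis_sum block_inner_commute)
qed

lemma H_radial:
  assumes y: "y \<in> \<Omega>"
  shows "block_inner b k y (H y v) = - block_inner b k v (h y)"
proof -
  have "((\<lambda>y. block_inner b k y (h y)) has_derivative
      (\<lambda>v. block_inner b k y (H y v) + block_inner b k v (h y))) (at y)"
    by (rule bounded_bilinear.FDERIV[OF bounded_bilinear_block_inner has_derivative_ident h_deriv[OF y]])
  moreover have "((\<lambda>y. block_inner b k y (h y)) has_derivative (\<lambda>v. 0)) (at y)"
    using h_radial
    by (intro has_derivative_transform_within_open[OF has_derivative_const open_nonzero_blocks y]) auto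
  ultimately have "(\<lambda>v. block_inner b k y (H y v) + block_inner b k v (h y)) = (\<lambda>v. 0)"
    by (rule has_derivative_unique)
  then have "block_inner b k y (H y v) + block_inner b k v (h y) = 0" by metis
  then show ?thesis by linarith
qed

lemma riemannian_grad_eq:
  assumes x: "x \<in> M"
  shows "riemannian_grad M f x = h x"
proof -
  note T = tangent_space_sphere_product[OF x]
  have "(f_ext has_derivative (\<lambda>v. h x \<bullet> v)) (at x within M)"
    using f_ext_gradient(1)[OF M_subset[OF x]] by (rule has_derivative_at_withinI)
  then have "(f has_derivative (\<lambda>v. h x \<bullet> v)) (at x within M)"
    using x by (rule has_derivative_transform[rotated 2]) (auto simp: f_ext_def block_normalize_sphere)
  then have D: "differential_on M f x u = h x \<bullet> u" if "u \<in> tangent_space M x" for u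
    using that by (rule differential_on_eq)
  have hT: "h x \<in> tangent_space M x" using h_radial[OF M_subset[OF x]] by (simp add: T)
  show ?thesis unfolding riemannian_grad_def
  proof (rule the_equality)
    show "h x \<in> tangent_space M x \<and> (\<forall>u\<in>tangent_space M x. differential_on M f x u = h x \<bullet> u)"
      using hT D by blast
    fix v assume v: "v \<in> tangent_space M x \<and> (\<forall>u\<in>tangent_space M x. differential_on M f x u = v \<bullet> u)"
    have d: "v - h x \<in> tangent_space M x" using v hT by (simp add: T block_inner_simps)
    then have "v \<bullet> (v - h x) = h x \<bullet> (v - h x)" using v D by metis
    then have "(v - h x) \<bullet> (v - h x) = 0" by (simp add: inner_diff_left)
    then show "v = h x" by simp
  qed
qed

lemma riemannian_Hess_eq:
  assumes x: "x \<in> M" and u: "u \<in> tangent_space M x"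
  shows "riemannian_Hess M f x u = closest_point (tangent_space M x) (H x u)"
proof -
  have "(h has_derivative H x) (at x within M)"
    using h_deriv[OF M_subset[OF x]] by (rule has_derivative_at_withinI)
  then have "(riemannian_grad M f has_derivative H x) (at x within M)"
    using x by (rule has_derivative_transform[rotated 2]) (auto simp: riemannian_grad_eq)
  then show ?thesis unfolding riemannian_Hess_def using u by (simp add: differential_on_eq)
qed

lemma tangent_space_subspace: "x \<in> M \<Longrightarrow> subspace (tangent_space M x)"
  by (simp add: tangent_space_sphere_product subspace_def block_inner_simps)

lemma Hess_inner:
  assumes x: "x \<in> M" and u: "u \<in> tangent_space M x"
  shows "u \<bullet> riemannian_Hess M f x u = u \<bullet> H x u"
proof -
  let ?T = "tangent_space M x"
  let ?p = "closest_point ?T (H x u)"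
  have T: "subspace ?T" using x by (rule tangent_space_subspace)
  have cl: "convex ?T" "closed ?T" using T by (auto intro: subspace_imp_convex closed_subspace)
  have p: "?p \<in> ?T" using cl u by (intro closest_point_in_set) auto
  have "?p + u \<in> ?T" "?p - u \<in> ?T" using T p u by (auto intro: subspace_add subspace_diff)
  from closest_point_dot[OF cl this(1), of "H x u"] closest_point_dot[OF cl this(2), of "H x u"]
  have "(H x u - ?p) \<bullet> u = 0" by simp
  then show ?thesis using riemannian_Hess_eq[OF x u]
    by (simp add: inner_diff_right inner_commute[of _ u])
qed

lemma Hess_critical:
  assumes x: "x \<in> M" and u: "u \<in> tangent_space M x" and hx: "h x = 0"
  shows "riemannian_Hess M f x u = H x u"
proof -
  have "H x u \<in> tangent_space M x"
    using H_radial[OF M_subset[OF x]] hx by (simp add: tangent_space_sphere_product[OF x])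
  then show ?thesis using riemannian_Hess_eq[OF x u] by (simp add: closest_point_self)
qed

end

section \<open>The gradient step\<close>

locale sphere_product_gd = sphere_product_function +
  fixes L \<alpha> :: real
  assumes L: "L > 0" and Lip: "grad_Lipschitz M f L" and \<alpha>: "0 < \<alpha>" "\<alpha> < 1 / L"
begin

definition q :: "'b \<Rightarrow> real ^ 'a \<Rightarrow> real" where
  "q k y = 1 + \<alpha>\<^sup>2 * block_inner b k y y * block_inner b k (h y) (h y)"

text \<open>The extension of the gradient step that commutes with all positive block scalings. On
  \<open>M\<close>, where the blocks of \<open>y\<close> are unit vectors orthogonal to those of \<open>h y\<close>, it is
  \<open>y - \<alpha> *\<^sub>R h y\<close> normalized blockwise.\<close>

definition G :: "real ^ 'a \<Rightarrow> real ^ 'a" where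
  "G y = block_scale b (\<lambda>k. q k y powr (- 1 / 2))
     (y - \<alpha> *\<^sub>R block_scale b (\<lambda>k. block_inner b k y y) (h y))"

lemma q_pos: "0 < q k y"
  by (simp add: q_def add_pos_nonneg)

lemma G_block_norm:
  assumes y: "y \<in> \<Omega>"
  shows "block_inner b k (G y) (G y) = block_inner b k y y"
proof -
  let ?r = "block_inner b k y y" and ?w = "y - \<alpha> *\<^sub>R block_scale b (\<lambda>k. block_inner b k y y) (h y)"
  have "block_inner b k ?w ?w = ?r * q k y"
    using h_radial[OF y, of k]
    by (simp add: block_inner_simps block_inner_commute[of b k "h y" y] q_def power2_eq_square algebra_simps)
  then have "block_inner b k (G y) (G y) = ?r * (q k y powr (- 1 / 2) * q k y powr (- 1 / 2) * q k y)"
    by (simp add: G_def mult_ac)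
  then show ?thesis using powr_minus_half_mult[OF q_pos] by simp
qed

lemma G_in: "y \<in> \<Omega> \<Longrightarrow> G y \<in> \<Omega>" "x \<in> M \<Longrightarrow> G x \<in> M"
  using G_block_norm M_subset by (auto simp: nonzero_blocks_def sphere_product_iff)

lemma G_pow_in: "y \<in> \<Omega> \<Longrightarrow> (G ^^ t) y \<in> \<Omega>" "x \<in> M \<Longrightarrow> (G ^^ t) x \<in> M"
  by (induction t) (auto intro: G_in)

lemma G_scale:
  assumes c: "\<And>k. 0 < c k" and y: "y \<in> \<Omega>"
  shows "G (block_scale b c y) = block_scale b c (G y)"
proof -
  have c0: "c k \<noteq> 0" for k using c[of k] by simp
  have q: "q k (block_scale b c y) = q k y" for k
    using c0 by (simp add: q_def h_scale[OF c y] field_simps)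
  have "block_scale b c y - \<alpha> *\<^sub>R block_scale b (\<lambda>k. c k * (c k * block_inner b k y y)) (block_scale b (\<lambda>k. inverse (c k)) (h y))
     = block_scale b c (y - \<alpha> *\<^sub>R block_scale b (\<lambda>k. block_inner b k y y) (h y))"
    using c0 by (simp add: block_scale_def vec_eq_iff algebra_simps)
  then show ?thesis unfolding G_def q
    by (simp add: h_scale[OF c y] mult.commute)
qed

lemma G_pow_scale:
  assumes "\<And>k. 0 < c k" "y \<in> \<Omega>"
  shows "(G ^^ t) (block_scale b c y) = block_scale b c ((G ^^ t) y)"
  using assms by (induction t) (auto simp: G_scale G_pow_in)

lemma RGD_step_eq:
  assumes x: "x \<in> M"
  shows "RGD_step M f \<alpha> x = G x"
proof -
  have one: "block_inner b k x x = 1" for k using x by (simp add: sphere_product_iff)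
  have w: "block_inner b k (x - \<alpha> *\<^sub>R h x) (x - \<alpha> *\<^sub>R h x) = q k x" for k
    using h_radial[OF M_subset[OF x], of k]
    by (simp add: block_inner_simps block_inner_commute[of b k "h x" x] q_def one power2_eq_square)
  then have "x - \<alpha> *\<^sub>R h x \<in> \<Omega>" using q_pos by (simp add: nonzero_blocks_def)
  then have "RGD_step M f \<alpha> x = block_normalize b (x - \<alpha> *\<^sub>R h x)"
    by (simp add: RGD_step_def riemannian_grad_eq[OF x] closest_point_sphere_product)
  also have "\<dots> = G x" by (simp add: block_normalize_def w G_def one)
  finally show ?thesis .
qed

lemma RGD_pow_eq: "x \<in> M \<Longrightarrow> (RGD_step M f \<alpha> ^^ t) x = (G ^^ t) x"
  by (induction t) (auto simp: RGD_step_eq G_pow_in)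

lemma Cn_on_q: "Cn_on 1 (q k) \<Omega>"
  unfolding q_def by (intro Cn_on_add Cn_on_mult Cn_on_const Cn_on_block_inner Cn_on_id f_ext_gradient)

lemma Cn_on_G: "Cn_on 1 G \<Omega>"
proof (rule Cn_on_vecI)
  fix i
  have nth: "Cn_on 1 (\<lambda>y. y $ i) \<Omega>" "Cn_on 1 (\<lambda>y. h y $ i) \<Omega>"
    by (intro Cn_on_linear_compose[OF bounded_linear_vec_nth] Cn_on_id f_ext_gradient)+
  have "Cn_on 1 (\<lambda>y. q (b i) y powr (- 1 / 2) * (y $ i - \<alpha> * (block_inner b (b i) y y * h y $ i))) \<Omega>"
    by (intro Cn_on_mult Cn_on_diff Cn_on_powr_compose Cn_on_q q_pos Cn_on_const Cn_on_block_inner Cn_on_id nth)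
  then show "Cn_on 1 (\<lambda>y. G y $ i) \<Omega>" by (simp add: G_def block_scale_def)
qed

definition DG :: "real ^ 'a \<Rightarrow> real ^ 'a \<Rightarrow> real ^ 'a" where
  "DG y = frechet_derivative G (at y)"

lemma G_deriv: "y \<in> \<Omega> \<Longrightarrow> (G has_derivative DG y) (at y)"
  and DG_cont: "continuous_on \<Omega> (\<lambda>y. DG y v)"
proof -
  obtain G' where G': "\<forall>x\<in>\<Omega>. (G has_derivative G' x) (at x)" "\<forall>v. continuous_on \<Omega> (\<lambda>x. G' x v)"
    using Cn_on_G by auto
  have "DG y = G' y" if "y \<in> \<Omega>" for y using G' that frechet_derivative_at by (force simp: DG_def)
  then show "y \<in> \<Omega> \<Longrightarrow> (G has_derivative DG y) (at y)" "continuous_on \<Omega> (\<lambda>y. DG y v)"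
    using G' by (auto cong: continuous_on_cong)
qed

text \<open>Differentiating \<open>sqrt (q k y) * G y $ i = y $ i - \<alpha> * (block_inner b k y y * h y $ i)\<close>
  together with the square of \<open>sqrt (q k y)\<close>.\<close>

lemma G_deriv_eq:
  assumes x: "x \<in> M"
  obtains s' where
    "\<And>v i. v $ i - \<alpha> * (2 * block_inner b (b i) x v * h x $ i + H x v $ i) =
       s' (b i) v * G x $ i + sqrt (q (b i) x) * DG x v $ i"
    "\<And>v k. h x = 0 \<Longrightarrow> s' k v = 0"
proof -
  have x\<Omega>: "x \<in> \<Omega>" using x by (rule M_subset)
  have one: "block_inner b k x x = 1" for k using x by (simp add: sphere_product_iff)
  have bi: "((\<lambda>y. block_inner b k y y) has_derivative (\<lambda>v. 2 * block_inner b k x v)) (at x)" for k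
    using bounded_bilinear.FDERIV[OF bounded_bilinear_block_inner[of b k] has_derivative_ident has_derivative_ident, of x UNIV]
    by (simp add: block_inner_commute[of b k _ x])
  have "Cn_on 1 (\<lambda>y. q k y powr (1 / 2)) \<Omega>" for k
    by (intro Cn_on_powr_compose Cn_on_q q_pos)
  then have "\<exists>D. ((\<lambda>y. q k y powr (1 / 2)) has_derivative D) (at x)" for k
    using x\<Omega> unfolding One_nat_def Cn_on.simps by blast
  then have "\<exists>D. ((\<lambda>y. sqrt (q k y)) has_derivative D) (at x)" for k
    using q_pos by (simp add: powr_half_sqrt less_imp_le)
  then obtain s' where s': "\<And>k. ((\<lambda>y. sqrt (q k y)) has_derivative s' k) (at x)" by metis
  have nth: "((\<lambda>y. F y $ i) has_derivative (\<lambda>v. D v $ i)) (at x)" if "(F has_derivative D) (at x)"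
    for F D and i :: 'a
    using bounded_linear.has_derivative[OF bounded_linear_vec_nth that] .
  have 1: "v $ i - \<alpha> * (2 * block_inner b (b i) x v * h x $ i + H x v $ i) =
       s' (b i) v * G x $ i + sqrt (q (b i) x) * DG x v $ i" for v i
  proof -
    have "((\<lambda>y. sqrt (q (b i) y) * G y $ i) has_derivative
        (\<lambda>v. sqrt (q (b i) x) * DG x v $ i + s' (b i) v * G x $ i)) (at x)"
      by (intro has_derivative_mult s' nth G_deriv x\<Omega>)
    moreover have "((\<lambda>y. y $ i - \<alpha> * (block_inner b (b i) y y * h y $ i)) has_derivative
        (\<lambda>v. v $ i - \<alpha> * (block_inner b (b i) x x * H x v $ i + 2 * block_inner b (b i) x v * h x $ i))) (at x)"
      by (intro has_derivative_diff has_derivative_mult_right has_derivative_mult bi nth h_deriv x\<Omega> has_derivative_ident)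
    moreover have "sqrt (q (b i) y) * G y $ i = y $ i - \<alpha> * (block_inner b (b i) y y * h y $ i)" for y
      using q_pos[of "b i" y] by (simp add: G_def block_scale_def powr_minus powr_half_sqrt)
    ultimately have "(\<lambda>v. sqrt (q (b i) x) * DG x v $ i + s' (b i) v * G x $ i) =
      (\<lambda>v. v $ i - \<alpha> * (block_inner b (b i) x x * H x v $ i + 2 * block_inner b (b i) x v * h x $ i))"
      by (auto dest: has_derivative_unique)
    from fun_cong[OF this, of v] show ?thesis by (simp add: one algebra_simps)
  qed
  have 2: "s' k v = 0" if hx: "h x = 0" for k v
  proof -
    have bh: "((\<lambda>y. block_inner b k (h y) (h y)) has_derivative (\<lambda>v. 0)) (at x)"
      using bounded_bilinear.FDERIV[OF bounded_bilinear_block_inner[of b k] h_deriv[OF x\<Omega>] h_deriv[OF x\<Omega>]]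
      by (simp add: hx)
    have "((\<lambda>y. 1 + \<alpha>\<^sup>2 * (block_inner b k y y * block_inner b k (h y) (h y))) has_derivative
        (\<lambda>v. 0 + \<alpha>\<^sup>2 * (block_inner b k x x * 0 + 2 * block_inner b k x v * block_inner b k (h x) (h x)))) (at x)"
      by (intro has_derivative_add has_derivative_const has_derivative_mult_right has_derivative_mult bi bh)
    then have "(q k has_derivative (\<lambda>v. 0)) (at x)"
      by (simp add: hx q_def[abs_def] mult.assoc)
    moreover have "((\<lambda>y. sqrt (q k y) * sqrt (q k y)) has_derivative
        (\<lambda>v. sqrt (q k x) * s' k v + s' k v * sqrt (q k x))) (at x)"
      by (intro has_derivative_mult s')
    moreover have "sqrt (q k y) * sqrt (q k y) = q k y" for y
      using q_pos[of k y] by simp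
    ultimately have "(\<lambda>v. sqrt (q k x) * s' k v + s' k v * sqrt (q k x)) = (\<lambda>v. 0)"
      by (auto dest: has_derivative_unique)
    from fun_cong[OF this, of v] show ?thesis using q_pos[of k x] by simp
  qed
  show thesis using 1 2 by (rule that)
qed

lemma DG_inj_sphere:
  assumes x: "x \<in> M"
  shows "inj (DG x)"
proof -
  have x\<Omega>: "x \<in> \<Omega>" using x by (rule M_subset)
  have one: "block_inner b k x x = 1" for k using x by (simp add: sphere_product_iff)
  have lin: "linear (DG x)" using G_deriv[OF x\<Omega>] by (rule has_derivative_linear)
  have "v = 0" if v: "DG x v = 0" for v
  proof -
    have xv: "block_inner b k x v = 0" for k
    proof -
      have "((\<lambda>y. block_inner b k (G y) (G y)) has_derivative
          (\<lambda>v. block_inner b k (G x) (DG x v) + block_inner b k (DG x v) (G x))) (at x)"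
        by (rule bounded_bilinear.FDERIV[OF bounded_bilinear_block_inner G_deriv[OF x\<Omega>] G_deriv[OF x\<Omega>]])
      moreover have "((\<lambda>y. block_inner b k (G y) (G y)) has_derivative
          (\<lambda>v. block_inner b k x v + block_inner b k v x)) (at x)"
        using bounded_bilinear.FDERIV[OF bounded_bilinear_block_inner has_derivative_ident has_derivative_ident]
          open_nonzero_blocks x\<Omega>
        by (rule has_derivative_transform_within_open) (simp add: G_block_norm)
      ultimately have "(\<lambda>v. block_inner b k (G x) (DG x v) + block_inner b k (DG x v) (G x)) =
          (\<lambda>v. block_inner b k x v + block_inner b k v x)"
        by (rule has_derivative_unique)
      from fun_cong[OF this, of v] show ?thesis by (simp add: v block_inner_commute)
    qed
    obtain s' where s': "\<And>v i. v $ i - \<alpha> * (2 * block_inner b (b i) x v * h x $ i + H x v $ i) =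
       s' (b i) v * G x $ i + sqrt (q (b i) x) * DG x v $ i"
      by (rule G_deriv_eq[OF x], rule that)
    then have *: "v $ i - \<alpha> * H x v $ i = s' (b i) v * G x $ i" for i
      using s'[of v i] by (simp add: xv v)
    define d where "d k = s' k v * q k x powr (- 1 / 2)" for k
    have vec: "v - \<alpha> *\<^sub>R H x v = block_scale b d (x - \<alpha> *\<^sub>R h x)"
      using * by (simp add: vec_eq_iff block_scale_def G_def d_def one mult.assoc)
    have d: "d k = \<alpha> * block_inner b k v (h x)" for k
      using arg_cong[OF vec, of "block_inner b k x"] h_radial[OF x\<Omega>, of k] H_radial[OF x\<Omega>, of k v]
      by (simp add: block_inner_simps xv one)
    have blk: "block_inner b k v v - \<alpha> * block_inner b k v (H x v) = - (\<alpha> * block_inner b k v (h x))\<^sup>2" for k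
      using arg_cong[OF vec, of "block_inner b k v"] xv[of k]
      by (simp add: block_inner_simps d block_inner_commute[of b k v x] power2_eq_square)
    have "v \<bullet> v - \<alpha> * (v \<bullet> H x v) = (\<Sum>k\<in>UNIV. - (\<alpha> * block_inner b k v (h x))\<^sup>2)"
      by (simp add: inner_block_inner[of _ _ b] sum_distrib_left blk flip: sum_subtractf)
    also have "\<dots> \<le> 0" by (intro sum_nonpos) simp
    finally have a: "v \<bullet> v \<le> \<alpha> * (v \<bullet> H x v)" by simp
    have vT: "v \<in> tangent_space M x" using xv by (simp add: tangent_space_sphere_product[OF x])
    have "v \<bullet> H x v \<le> norm v * norm (riemannian_Hess M f x v)"
      unfolding Hess_inner[OF x vT, symmetric] by (rule norm_cauchy_schwarz)
    also have "\<dots> \<le> norm v * (L * norm v)"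
      using Lip x vT by (intro mult_left_mono) (auto simp: grad_Lipschitz_def)
    finally have "\<alpha> * (v \<bullet> H x v) \<le> \<alpha> * (L * (v \<bullet> v))"
      using \<alpha> by (intro mult_left_mono) (auto simp: power2_norm_eq_inner[symmetric] power2_eq_square mult_ac)
    with a have "(1 - \<alpha> * L) * (v \<bullet> v) \<le> 0" by (simp add: algebra_simps)
    moreover have "1 - \<alpha> * L > 0" using \<alpha>(2) L by (simp add: pos_less_divide_eq)
    ultimately have "v \<bullet> v \<le> 0" by (simp add: mult_le_0_iff)
    then have "v \<bullet> v = 0" using inner_ge_zero[of v] by linarith
    then show "v = 0" by simp
  qed
  then show ?thesis by (simp add: linear_injective_0[OF lin])
qed

lemma DG_inj:
  assumes y: "y \<in> \<Omega>"
  shows "inj (DG y)"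
proof -
  define c where "c k = sqrt (block_inner b k y y)" for k
  define p where "p = block_normalize b y"
  have p: "p \<in> M" "block_scale b c p = y"
    using block_normalize_in[OF y] block_scale_normalize[OF y] by (simp_all add: p_def c_def[abs_def])
  have c: "0 < c k" for k using y by (simp add: c_def nonzero_blocks_def)
  then have c0: "c k \<noteq> 0" for k by (simp add: less_imp_neq[symmetric])
  have ic: "0 < inverse (c k)" for k using c by simp
  let ?T = "block_scale b c" and ?T' = "block_scale b (\<lambda>k. inverse (c k))"
  have py: "?T' y = p" using p(2) block_scale_inverse(2)[of c b p] c0 by simp
  have "((\<lambda>z. G (?T' z)) has_derivative (\<lambda>v. DG p (?T' v))) (at y)"
    using G_deriv[OF M_subset[OF p(1)]]
    by (intro has_derivative_compose[OF bounded_linear_imp_has_derivative[OF bounded_linear_block_scale]])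
      (simp add: py)
  then have "((\<lambda>z. ?T (G (?T' z))) has_derivative (\<lambda>v. ?T (DG p (?T' v)))) (at y)"
    by (rule bounded_linear.has_derivative[OF bounded_linear_block_scale])
  then have "(G has_derivative (\<lambda>v. ?T (DG p (?T' v)))) (at y)"
    using open_nonzero_blocks y
    by (rule has_derivative_transform_within_open) (use c0 ic in \<open>simp add: G_scale\<close>)
  then have eq: "DG y = (\<lambda>v. ?T (DG p (?T' v)))"
    using G_deriv[OF y] has_derivative_unique by blast
  have "inj (?T \<circ> (DG p \<circ> ?T'))"
    using DG_inj_sphere[OF p(1)] bij_block_scale[of c b] bij_block_scale[of "\<lambda>k. inverse (c k)" b] c0
    by (intro inj_compose) (auto simp: bij_is_inj)
  then show ?thesis by (simp add: eq o_def)
qed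

lemma negligible_trapped_near_saddle:
  assumes "strict_saddle M f x"
  shows "\<exists>\<delta>>0. negligible {y. \<forall>t. (G ^^ t) y \<in> ball x \<delta>}"
proof -
  obtain \<mu> u where x: "x \<in> M" and g: "riemannian_grad M f x = 0" and \<mu>: "\<mu> < 0"
    and u: "u \<in> tangent_space M x" "u \<noteq> 0" "riemannian_Hess M f x u = \<mu> *\<^sub>R u"
    using assms unfolding strict_saddle_def by blast
  have x\<Omega>: "x \<in> \<Omega>" using x by (rule M_subset)
  have hx: "h x = 0" using g by (simp add: riemannian_grad_eq[OF x])
  have Hu: "H x u = \<mu> *\<^sub>R u" using Hess_critical[OF x u(1) hx] u(3) by simp
  have q1: "q k x = 1" for k by (simp add: q_def hx)
  obtain s' where 1: "\<And>v i. v $ i - \<alpha> * (2 * block_inner b (b i) x v * h x $ i + H x v $ i) =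
       s' (b i) v * G x $ i + sqrt (q (b i) x) * DG x v $ i" and 2: "\<And>v k. s' k v = 0"
    using G_deriv_eq[OF x] hx by metis
  have DG: "DG x v = v - \<alpha> *\<^sub>R H x v" for v
    using 1[of v] by (simp add: vec_eq_iff 2 q1 hx)
  show ?thesis
  proof (rule negligible_trapped_near_unstable_fixpoint)
    show "linear (DG x)" using G_deriv[OF x\<Omega>] by (rule has_derivative_linear)
    show "DG x v \<bullet> w = v \<bullet> DG x w" for v w
      using H_sym[OF x\<Omega>] by (simp add: DG inner_diff_left inner_diff_right)
    show "u \<noteq> 0" by (rule u(2))
    show "DG x u = (1 - \<alpha> * \<mu>) *\<^sub>R u" by (simp add: DG Hu algebra_simps)
    have "\<alpha> * \<mu> < 0" using \<alpha>(1) \<mu> by (simp add: mult_pos_neg)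
    then show "1 < (1 - \<alpha> * \<mu>)\<^sup>2" by (intro one_less_power) auto
    show "\<exists>\<delta>>0. \<forall>y\<in>ball x \<delta>. \<forall>z\<in>ball x \<delta>. norm (G y - G z - DG x (y - z)) \<le> \<epsilon> * norm (y - z)"
      if "\<epsilon> > 0" for \<epsilon>
      using open_nonzero_blocks G_deriv DG_cont x\<Omega> that by (rule has_derivative_strict)
  qed
qed

lemma negligible_G_pow_vimage:
  assumes "negligible N"
  shows "negligible {y \<in> \<Omega>. (G ^^ t) y \<in> N}"
proof (induction t)
  case 0
  show ?case using assms by (rule negligible_subset) auto
next
  case (Suc t)
  have "negligible {y \<in> \<Omega>. G y \<in> {y \<in> \<Omega>. (G ^^ t) y \<in> N}}"
    by (rule negligible_differentiable_vimage[OF Suc DG_inj has_derivative_at_withinI[OF G_deriv]])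
  then show ?case by (rule negligible_subset) (auto simp: G_in funpow_swap1)
qed

lemma negligible_cone_over_saddle_basins:
  "negligible {y \<in> \<Omega>. \<exists>x. strict_saddle M f x \<and> (\<lambda>t. (G ^^ t) (block_normalize b y)) \<longlonglongrightarrow> x}"
    (is "negligible ?C")
proof -
  let ?\<F> = "{B. open B \<and> negligible {y \<in> \<Omega>. \<forall>t. (G ^^ t) y \<in> B}}"
  obtain \<F> where \<F>: "\<F> \<subseteq> ?\<F>" "countable \<F>" "\<Union>\<F> = \<Union>?\<F>"
    using Lindelof[of ?\<F>] by blast
  have cover: "block_scale b c x \<in> \<Union>?\<F>" if x: "strict_saddle M f x" and c: "\<And>k. 0 < c k" for x c
  proof -
    obtain \<delta> where \<delta>: "\<delta> > 0" "negligible {y. \<forall>t. (G ^^ t) y \<in> ball x \<delta>}" (is "negligible ?N")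
      using negligible_trapped_near_saddle[OF x] by blast
    let ?T = "block_scale b c" and ?T' = "block_scale b (\<lambda>k. inverse (c k))"
    have c0: "c k \<noteq> 0" for k using c[of k] by simp
    have lin: "linear ?T" using bounded_linear_block_scale by (rule bounded_linear.linear)
    have bij: "bij ?T" using c0 by (rule bij_block_scale)
    have op: "open (?T ` ball x \<delta>)"
      using lin bij by (intro open_surjective_linear_image) (auto simp: bij_is_surj)
    have "{y \<in> \<Omega>. \<forall>t. (G ^^ t) y \<in> ?T ` ball x \<delta>} \<subseteq> ?T ` ?N"
    proof
      fix y assume y: "y \<in> {y \<in> \<Omega>. \<forall>t. (G ^^ t) y \<in> ?T ` ball x \<delta>}"
      have y': "?T' y \<in> \<Omega>" and Ty: "?T (?T' y) = y" using y c0 by (auto intro: block_scale_nonzero_blocks)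
      have "(G ^^ t) (?T' y) \<in> ball x \<delta>" for t
      proof -
        have eq: "(G ^^ t) y = ?T ((G ^^ t) (?T' y))"
          using G_pow_scale[of c, OF c y', of t] unfolding Ty .
        have "(G ^^ t) y \<in> ?T ` ball x \<delta>" using y by blast
        then have "?T ((G ^^ t) (?T' y)) \<in> ?T ` ball x \<delta>" unfolding eq .
        then show ?thesis unfolding inj_image_mem_iff[OF bij_is_inj[OF bij]] .
      qed
      then have "?T' y \<in> ?N" by blast
      then have "?T (?T' y) \<in> ?T ` ?N" by (rule imageI)
      then show "y \<in> ?T ` ?N" unfolding Ty .
    qed
    moreover have "negligible (?T ` ?N)" 
      using \<delta>(2) by (intro negligible_differentiable_image_negligible linear_imp_differentiable_on lin) auto
    ultimately have "?T ` ball x \<delta> \<in> ?\<F>" using op negligible_subset by blast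
    then show ?thesis using \<delta>(1) by (intro UnionI) auto
  qed
  have "?C \<subseteq> (\<Union>B\<in>\<F>. \<Union>t. {y \<in> \<Omega>. (G ^^ t) y \<in> {y \<in> \<Omega>. \<forall>t. (G ^^ t) y \<in> B}})"
  proof
    fix y assume "y \<in> ?C"
    then obtain x where y: "y \<in> \<Omega>" and x: "strict_saddle M f x"
      and lim: "(\<lambda>t. (G ^^ t) (block_normalize b y)) \<longlonglongrightarrow> x" by blast
    define c where "c k = sqrt (block_inner b k y y)" for k
    have c: "0 < c k" for k using y by (simp add: c_def nonzero_blocks_def)
    have yc: "block_scale b c (block_normalize b y) = y"
      using block_scale_normalize[OF y] by (simp add: c_def[abs_def])
    have n: "block_normalize b y \<in> \<Omega>" using block_normalize_in[OF y] by (rule M_subset)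
    have eq: "(G ^^ t) y = block_scale b c ((G ^^ t) (block_normalize b y))" for t
      using G_pow_scale[of c, OF c n, of t] unfolding yc .
    have "(\<lambda>t. block_scale b c ((G ^^ t) (block_normalize b y))) \<longlonglongrightarrow> block_scale b c x"
      using lim by (rule bounded_linear.tendsto[OF bounded_linear_block_scale])
    then have lim': "(\<lambda>t. (G ^^ t) y) \<longlonglongrightarrow> block_scale b c x"
      by (simp only: eq)
    have "block_scale b c x \<in> \<Union>\<F>" unfolding \<F>(3) using x c by (rule cover)
    then obtain B where B: "B \<in> \<F>" "block_scale b c x \<in> B" by (rule UnionE)
    then have "open B" using \<F>(1) by blast
    from topological_tendstoD[OF lim' this B(2)]
    obtain t0 where t0: "\<forall>t\<ge>t0. (G ^^ t) y \<in> B"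
      unfolding eventually_sequentially by (rule exE)
    have "(G ^^ t) ((G ^^ t0) y) \<in> B" for t
      using t0[rule_format, of "t + t0"] by (simp add: funpow_add)
    then show "y \<in> (\<Union>B\<in>\<F>. \<Union>t. {y \<in> \<Omega>. (G ^^ t) y \<in> {y \<in> \<Omega>. \<forall>t. (G ^^ t) y \<in> B}})"
      using B(1) y G_pow_in(1)[OF y] by blast
  qed
  moreover have "negligible (\<Union>B\<in>\<F>. \<Union>t. {y \<in> \<Omega>. (G ^^ t) y \<in> {y \<in> \<Omega>. \<forall>t. (G ^^ t) y \<in> B}})"
  proof (rule negligible_countable_Union)
    show "countable ((\<lambda>B. \<Union>t. {y \<in> \<Omega>. (G ^^ t) y \<in> {y \<in> \<Omega>. \<forall>t. (G ^^ t) y \<in> B}}) ` \<F>)"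
      using \<F>(2) by simp
    fix S assume "S \<in> (\<lambda>B. \<Union>t. {y \<in> \<Omega>. (G ^^ t) y \<in> {y \<in> \<Omega>. \<forall>t. (G ^^ t) y \<in> B}}) ` \<F>"
    then obtain B where B: "B \<in> \<F>" "S = (\<Union>t. {y \<in> \<Omega>. (G ^^ t) y \<in> {y \<in> \<Omega>. \<forall>t. (G ^^ t) y \<in> B}})"
      by blast
    have N: "negligible {y \<in> \<Omega>. \<forall>t. (G ^^ t) y \<in> B}" using B(1) \<F>(1) by blast
    show "negligible S"
      unfolding B(2) by (rule negligible_countable_Union) (use negligible_G_pow_vimage[OF N] in auto)
  qed
  ultimately show ?thesis using negligible_subset by blast
qed

end

section \<open>Passing from cones to charts\<close>

lemma negligible_Times_slice:
  fixes A :: "'a::euclidean_space set" and B :: "'b::euclidean_space set"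
  assumes "negligible (B \<times> A)" and "open B" "B \<noteq> {}"
  shows "negligible A"
proof -
  obtain N where N: "N \<in> null_sets (lborel :: ('b \<times> 'a) measure)" "B \<times> A \<subseteq> N"
    using assms(1) by (auto simp: negligible_iff_null_sets null_sets_completion_iff2)
  have "AE z in (lborel :: ('b \<times> 'a) measure). z \<notin> N" using N(1) by (rule AE_not_in)
  then have "AE z in (lborel :: 'b measure) \<Otimes>\<^sub>M (lborel :: 'a measure). z \<notin> N"
    unfolding lborel_prod .
  then have "AE x in (lborel :: 'b measure). AE y in (lborel :: 'a measure). (x, y) \<notin> N"
    by (rule lborel_pair.AE_pair)
  then obtain Z where Z: "Z \<in> null_sets lborel"
      "{x. \<not> (AE y in (lborel :: 'a measure). (x, y) \<notin> N)} \<subseteq> Z"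
    by (auto simp: eventually_ae_filter)
  have "\<not> negligible B" using assms(2,3) open_not_negligible by blast
  moreover have "negligible Z" using Z(1) by (simp add: negligible_iff_null_sets null_sets_completionI)
  ultimately have "\<not> B \<subseteq> Z" using negligible_subset by blast
  then obtain x where x: "x \<in> B" "AE y in (lborel :: 'a measure). (x, y) \<notin> N" using Z(2) by blast
  then obtain Y where Y: "Y \<in> null_sets lborel" "{y. \<not> (x, y) \<notin> N} \<subseteq> Y"
    by (auto simp: eventually_ae_filter)
  have "A \<subseteq> Y" using Y(2) N(2) x(1) by blast
  moreover have "negligible Y" using Y(1) by (simp add: negligible_iff_null_sets null_sets_completionI)
  ultimately show ?thesis using negligible_subset by blast
qed

text \<open>In a chart, the cone over \<open>A\<close> is the product of \<open>A\<close> with the open set of possible block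
  norms, so that Fubini's theorem applies.\<close>

lemma measure_zero_in_sphere_product:
  fixes b :: "'n::finite \<Rightarrow> 'k::finite"
  assumes neg: "negligible {y \<in> nonzero_blocks b. block_normalize b y \<in> A}"
    and A: "A \<subseteq> sphere_product b" and dim: "CARD('n) \<le> CARD('k) + CARD('m::finite)"
  shows "measure_zero_in TYPE('m) (sphere_product b) A"
  unfolding measure_zero_in_def
proof (intro conjI A allI impI)
  fix U and \<phi> :: "real ^ 'n \<Rightarrow> real ^ 'm"
  assume "smooth_chart (sphere_product b) U \<phi>"
  then have sm: "Ck_on_submanifold \<infinity> \<phi> U" by (simp add: smooth_chart_def)
  let ?\<Omega> = "nonzero_blocks b" and ?\<pi> = "block_normalize b"
  define C where "C = {y \<in> ?\<Omega>. ?\<pi> y \<in> A \<inter> U}"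
  define R where "R y = (\<chi> k. block_inner b k y y)" for y
  define B where "B = {r :: real ^ 'k. \<forall>k. 0 < r $ k}"
  have \<pi>: "continuous_on ?\<Omega> ?\<pi>" "Cn_on 1 ?\<pi> ?\<Omega>"
    using Cn_on_block_normalize Cn_on_imp_continuous_on by blast+
  have "\<phi> \<circ> ?\<pi> differentiable (at y within C)" if y: "y \<in> C" for y
  proof -
    obtain V F where V: "open V" "?\<pi> y \<in> V" "Ck_on \<infinity> F V" "\<forall>z\<in>V \<inter> U. F z = \<phi> z"
      using sm y unfolding Ck_on_submanifold_def C_def by blast
    have "Cn_on 1 F V" using V(3) by (simp add: Ck_on_def del: Cn_on.simps)
    then have "F differentiable (at (?\<pi> y))" using V(2) by (auto simp: differentiable_def)
    moreover have "?\<pi> differentiable (at y)" using \<pi>(2) y by (auto simp: differentiable_def C_def)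
    ultimately have F: "F \<circ> ?\<pi> differentiable (at y within C)"
      using differentiable_chain_at differentiable_at_withinI by blast
    have "open (?\<pi> -` V \<inter> ?\<Omega>)"
      using \<pi>(1) V(1) open_nonzero_blocks by (metis continuous_on_open_vimage Int_commute)
    then obtain d where d: "d > 0" "ball y d \<subseteq> ?\<pi> -` V \<inter> ?\<Omega>"
      using y V(2) open_contains_ball by (metis (no_types, lifting) C_def IntI mem_Collect_eq vimageI)
    from F d(1) y show ?thesis
      by (rule differentiable_transform_within)
        (use V(4) d(2) in \<open>auto simp: C_def dist_commute subset_iff\<close>)
  qed
  moreover have "R differentiable (at y within C)" for y
  proof -
    have "Cn_on 1 R UNIV" unfolding R_def
      by (rule Cn_on_vecI) (simp add: Cn_on_block_inner del: Cn_on.simps)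
    then show ?thesis by (auto simp: differentiable_def intro: has_derivative_at_withinI)
  qed
  ultimately have "(\<lambda>y. (R y, \<phi> (?\<pi> y))) differentiable_on C"
    unfolding differentiable_on_def differentiable_def o_def by (metis has_derivative_Pair)
  moreover have "negligible C" using neg by (rule negligible_subset) (auto simp: C_def)
  ultimately have neg': "negligible ((\<lambda>y. (R y, \<phi> (?\<pi> y))) ` C)"
    using dim by (intro negligible_differentiable_image_negligible) auto
  have "B \<times> \<phi> ` (A \<inter> U) \<subseteq> (\<lambda>y. (R y, \<phi> (?\<pi> y))) ` C"
  proof clarify
    fix r p assume r: "r \<in> B" and p: "p \<in> A" "p \<in> U"
    define y where "y = block_scale b (\<lambda>k. sqrt (r $ k)) p"
    have pM: "p \<in> sphere_product b" using p A by blast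
    then have p\<Omega>: "p \<in> ?\<Omega>" using sphere_product_subset by blast
    have pos: "0 < sqrt (r $ k)" for k using r by (simp add: B_def)
    have "?\<pi> y = p"
      unfolding y_def by (simp add: block_normalize_scale[OF pos p\<Omega>] block_normalize_sphere[OF pM])
    moreover have "y \<in> ?\<Omega>"
      unfolding y_def using pos p\<Omega> by (intro block_scale_nonzero_blocks) (auto simp: less_imp_neq[symmetric])
    moreover have "R y = r"
      using pos pM by (simp add: R_def y_def vec_eq_iff sphere_product_iff less_imp_le)
    ultimately show "(r, \<phi> p) \<in> (\<lambda>y. (R y, \<phi> (?\<pi> y))) ` C"
      using p by (intro image_eqI[of _ _ y]) (auto simp: C_def)
  qed
  then have "negligible (B \<times> \<phi> ` (A \<inter> U))" using neg' negligible_subset by blast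
  moreover have "open B" unfolding B_def Collect_all_eq
    by (intro open_INT finite ballI open_Collect_less continuous_intros)
  moreover have "(\<chi> k. 1) \<in> B" by (simp add: B_def)
  ultimately have "negligible (\<phi> ` (A \<inter> U))" using negligible_Times_slice by blast
  then show "\<phi> ` (A \<inter> U) \<in> null_sets lebesgue" by (simp add: negligible_iff_null_sets)
qed

theorem proposition6p2:
  fixes d :: "'k::finite \<Rightarrow> nat"
    and b :: "'n::finite \<Rightarrow> 'k"
    and M :: "(real ^ 'n) set"
    and f :: "real ^ 'n \<Rightarrow> real"
    and L \<alpha> :: real
  assumes "\<And>k. card (b -` {k}) = d k + 1"
    and "CARD('m::finite) = (\<Sum>k\<in>UNIV. d k)"
    and "M = sphere_product b"
    and "Ck_on_submanifold 2 f M"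
    and "L > 0"
    and "grad_Lipschitz M f L"
    and "0 < \<alpha>" and "\<alpha> < 1 / L"
  shows "measure_zero_in TYPE('m) M
           {x0 \<in> M. \<exists>x. strict_saddle M f x \<and>
              (\<lambda>t. (RGD_step M f \<alpha> ^^ t) x0) \<longlonglongrightarrow> x}"
proof -
  interpret sphere_product_gd b f L \<alpha>
    using assms by unfold_locales simp_all
  let ?A = "{x0 \<in> M. \<exists>x. strict_saddle M f x \<and> (\<lambda>t. (RGD_step M f \<alpha> ^^ t) x0) \<longlonglongrightarrow> x}"
  have "CARD('n) = (\<Sum>k\<in>UNIV. card (b -` {k}))"
    using sum.group[of UNIV UNIV b "\<lambda>i. 1::nat"] by (simp add: vimage_def)
  also have "\<dots> = CARD('k) + CARD('m)" by (simp add: assms(1,2) sum_Suc)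
  finally have dim: "CARD('n) \<le> CARD('k) + CARD('m)" by simp
  have "negligible {y \<in> nonzero_blocks b. block_normalize b y \<in> ?A}"
    using negligible_cone_over_saddle_basins
    by (rule negligible_subset) (auto simp: assms(3) RGD_pow_eq)
  then show ?thesis
    unfolding assms(3) by (rule measure_zero_in_sphere_product[OF _ _ dim]) auto
qed

end
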